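(* Let $\Lambda$ be a $\sigma$-compact metric space and let $\sigma\in\mathfrak{M}(\Lambda)$. Let $\mathrm{P}_M$ be a probability measure on $\mathfrak{M}(\Lambda)$, let $M$ be the canonical random variable $M(m)=m$, and let $\mu'_\sigma$, $\mu'_M$ be the probability measures on $\Gamma_\Lambda\times\mathfrak{M}(\Lambda)$ given by $$d\mu'_\sigma(\omega,m)=d\mu_\sigma(\omega)\,d\mathrm{P}_M(m),\qquad d\mu'_M(\omega,m)=d\mu_m(\omega)\,d\mathrm{P}_M(m).$$ Assume that, $\mu'_\sigma$-a.s., the measure $M$ is absolutely continuous with respect to $\sigma$, and that there exists a measurable version of $dM/d\sigma$ such that $dM/d\sigma-1\in L^1(\mu'_\sigma\otimes\sigma)$. Then $$\mathcal{T}_{\rho_1}(\mu'_\sigma,\mu'_M)\le\mathbb{E}_{\mu'_\sigma}\left[\int_\Lambda\left|\frac{dM}{d\sigma}(x)-1\right|d\sigma(x)\right].$$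
   Context: $\Gamma_\Lambda=\{\omega\subset\Lambda : \omega\cap K \text{ is finite for every compact } K\}$ is the configuration space, with $\omega\in\Gamma_\Lambda$ identified with the Radon measure $\sum_{x\in\omega}\varepsilon_x$ (sum of Dirac masses). It carries the vague topology (the weakest topology making $\omega\mapsto\int_\Lambda f\,d\omega$ continuous for every continuous compactly supported $f$) and its Borel $\sigma$-algebra. $\mathfrak{M}(\Lambda)$ is the space of positive diffuse Radon measures on $\Lambda$ with the vague topology and the corresponding Borel $\sigma$-field. For $m\in\mathfrak M(\Lambda)$, $\mu_m$ denotes the Poisson measure of intensity $m$ on $\Gamma_\Lambda$, characterized by $\mathbb{E}_{\mu_m}[\exp(\int_\Lambda f\,d\omega)]=\exp\{\int_\Lambda(e^f-1)\,dm\}$ for all continuous compactly supported $f$. The total variation distance (possibly infinite) on $\Gamma_\Lambda$ is $\rho_1(\omega,\eta)=\sum_{x\in\Lambda}|\omega(\{x\})-\eta(\{x\})|$, and $\rho_1\text{-Lip}_1$ is the set of bounded (measurable) functions $F:\Gamma_\Lambda\to\mathbb{R}$ with $|F(\omega)-F(\eta)|\le\rho_1(\omega,\eta)$ for all $\omega,\eta$. The distance between $\mu'_\sigma$ and $\mu'_M$ does not include any information on $M$; it is $$\mathcal{T}_{\rho_1}(\mu'_\sigma,\mu'_M)=\sup_{F\in\rho_1\text{-Lip}_1}\left(\int_{\Gamma_\Lambda\times\mathfrak{M}(\Lambda)}F(\omega)\,d\mu'_\sigma(\omega,m)-\int_{\Gamma_\Lambda\times\mathfrak{M}(\Lambda)}F(\omega)\,d\mu'_M(\omega,m)\right).$$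 *)

theory Defs
  imports "HOL-Probability.Probability"
begin

section \<open>Preliminaries on topological spaces\<close>

definition sigma_compact :: "'a::topological_space set \<Rightarrow> bool" where
  "sigma_compact S \<longleftrightarrow> (\<exists>\<C>. countable \<C> \<and> (\<forall>K\<in>\<C>. compact K) \<and> \<Union>\<C> = S)"

definition compactly_supported :: "('a::topological_space \<Rightarrow> real) set" where
  "compactly_supported = {f. continuous_on UNIV f \<and> compact (closure (support_on UNIV f))}"

definition borel_of :: "'b topology \<Rightarrow> 'b measure" where
  "borel_of X = sigma (topspace X) {U. openin X U}"


section \<open>Diffuse Radon measures and configurations\<close>

definition diffuse_radon :: "'a::metric_space measure set" where
  "diffuse_radon = {m. sets m = sets borel
     \<and> (\<forall>K. compact K \<longrightarrow> emeasure m K < \<infinity>)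
     \<and> (\<forall>A\<in>sets borel. emeasure m A = (SUP K\<in>{K. compact K \<and> K \<subseteq> A}. emeasure m K))
     \<and> (\<forall>x. emeasure m {x} = 0)}"

definition configurations :: "'a::metric_space set set" where
  "configurations = {\<omega>. \<forall>K. compact K \<longrightarrow> finite (\<omega> \<inter> K)}"

text \<open>The sum of the Dirac masses at the points of \<open>\<omega>\<close>, that is, the measure
  counting the points of \<open>\<omega>\<close> in a Borel set.\<close>

definition config_measure :: "'a::metric_space set \<Rightarrow> 'a measure" where
  "config_measure \<omega> = distr (count_space \<omega>) borel (\<lambda>x. x)"

text \<open>The vague topology on a set \<open>X\<close> whose elements are identified with measures via \<open>\<phi>\<close>:
  the initial topology of the maps sending \<open>x\<close> to the integral of \<open>f\<close> with respect to \<open>\<phi> x\<close>,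
  for \<open>f\<close> continuous with compact support.\<close>

definition vague_topology :: "'b set \<Rightarrow> ('b \<Rightarrow> 'a::metric_space measure) \<Rightarrow> 'b topology" where
  "vague_topology X \<phi> = topology_generated_by
     {{x \<in> X. (\<integral>y. f y \<partial>(\<phi> x)) \<in> U} | f U. f \<in> compactly_supported \<and> open U}"

lemma topspace_vague_topology: "topspace (vague_topology X \<phi>) = X"
proof -
  have "(\<lambda>_. 0) \<in> compactly_supported"
    by (simp add: compactly_supported_def support_on_def)
  then have "X \<in> {{x \<in> X. (\<integral>y. f y \<partial>(\<phi> x)) \<in> U} | f U. f \<in> compactly_supported \<and> open U}"
    by (intro CollectI exI[of _ "\<lambda>_. 0"] exI[of _ UNIV]) auto
  then show ?thesis
    unfolding vague_topology_def topology_generated_by_topspace by blast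
qed

definition config_borel :: "'a::metric_space set measure" where
  "config_borel = borel_of (vague_topology configurations config_measure)"

definition radon_borel :: "'a::metric_space measure measure" where
  "radon_borel = borel_of (vague_topology diffuse_radon (\<lambda>m. m))"


section \<open>Poisson measures\<close>

text \<open>\<open>is_poisson m P\<close>: the law \<open>P\<close> is the Poisson measure of intensity \<open>m\<close>.
  Since the right-hand side is nonzero and the Bochner integral of a non-integrable function
  is \<open>0\<close>, the identity includes the integrability of \<open>\<lambda>\<omega>. exp (\<integral>x. f x \<partial>config_measure \<omega>)\<close>.\<close>

definition is_poisson :: "'a::metric_space measure \<Rightarrow> 'a set measure \<Rightarrow> bool" where
  "is_poisson m P \<longleftrightarrow> prob_space P \<and> sets P = sets config_borel \<and>
     (\<forall>f\<in>compactly_supported.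
        (\<integral>\<omega>. exp (\<integral>x. f x \<partial>config_measure \<omega>) \<partial>P) = exp (\<integral>x. (exp (f x) - 1) \<partial>m))"

text \<open>In the following two measures, \<open>\<mu> m\<close> stands for the Poisson measure of intensity \<open>m\<close>.
  The second one is \<open>d\<mu>\<^sub>m(\<omega>) dP(m)\<close>: draw \<open>m\<close> from \<open>P\<close>, then \<open>\<omega>\<close> from \<open>\<mu> m\<close>.\<close>

definition fixed_joint ::
  "('a::metric_space measure \<Rightarrow> 'a set measure) \<Rightarrow> 'a measure measure \<Rightarrow> 'a measure
    \<Rightarrow> ('a set \<times> 'a measure) measure" where
  "fixed_joint \<mu> P \<sigma> = \<mu> \<sigma> \<Otimes>\<^sub>M P"

definition mixed_joint ::
  "('a::metric_space measure \<Rightarrow> 'a set measure) \<Rightarrow> 'a measure measure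
    \<Rightarrow> ('a set \<times> 'a measure) measure" where
  "mixed_joint \<mu> P =
     P \<bind> (\<lambda>m. distr (\<mu> m) (config_borel \<Otimes>\<^sub>M radon_borel) (\<lambda>\<omega>. (\<omega>, m)))"


section \<open>The transport distance\<close>

definition rho1 :: "'a::metric_space set \<Rightarrow> 'a set \<Rightarrow> ennreal" where
  "rho1 \<omega> \<eta> = (\<Sum>\<^sub>\<infinity>x. ennreal \<bar>measure (config_measure \<omega>) {x} - measure (config_measure \<eta>) {x}\<bar>)"

definition rho1_Lip1 :: "('a::metric_space set \<Rightarrow> real) set" where
  "rho1_Lip1 = {F \<in> borel_measurable config_borel. bounded (F ` configurations) \<and>
     (\<forall>\<omega>\<in>configurations. \<forall>\<eta>\<in>configurations. ennreal \<bar>F \<omega> - F \<eta>\<bar> \<le> rho1 \<omega> \<eta>)}"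

definition transport_rho1 ::
  "('a::metric_space set \<times> 'a measure) measure \<Rightarrow> ('a set \<times> 'a measure) measure \<Rightarrow> ereal" where
  "transport_rho1 \<nu> \<nu>' =
     (SUP F\<in>rho1_Lip1. ereal ((\<integral>p. F (fst p) \<partial>\<nu>) - (\<integral>p. F (fst p) \<partial>\<nu>')))"

end

theory Submission
  imports Defs
begin

text \<open>Fix a diffuse Radon measure \<open>m\<close> and write \<open>h = dm/d\<sigma>\<close>. The measures \<open>\<sigma>\<close> and \<open>m\<close> share the part
  \<open>\<alpha> = min 1 h \<sigma>\<close>: both arise from \<open>\<alpha>\<close> by adding a finite measure, namely \<open>(1 - h)\<^sup>+ \<sigma>\<close> and
  \<open>(h - 1)\<^sup>+ \<sigma>\<close>, and the two added masses sum to \<open>\<integral>\<bar>h - 1\<bar> d\<sigma>\<close>. If \<open>\<beta>\<close> is finite and diffuse with mass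
  \<open>t\<close>, then a Poisson configuration of intensity \<open>\<alpha> + \<beta>\<close> is a Poisson configuration of intensity
  \<open>\<alpha>\<close> to which a Poisson number, of mean \<open>t\<close>, of independent points with law \<open>\<beta>/t\<close> is added. Adding
  one point changes a \<open>\<rho>\<^sub>1\<close>-Lipschitz function by at most 1, so passing from \<open>\<alpha>\<close> to \<open>\<alpha> + \<beta>\<close> changes its
  expectation by at most \<open>t\<close> (\<open>poisson_density_Lip1\<close>). Going from \<open>\<sigma>\<close> to \<open>m\<close> through \<open>\<alpha>\<close> bounds the
  difference of expectations under the two Poisson measures by \<open>\<integral>\<bar>h - 1\<bar> d\<sigma>\<close>
  (\<open>poisson_Lip1_RN_deriv\<close>); the theorem follows by integrating over \<open>m\<close>.

  The decomposition with added points is recognised through Laplace functionals. These determine laws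
  on the \<open>\<sigma>\<close>-algebra that they generate, by a monotone class theorem
  (\<open>functional_monotone_class\<close>), and the same theorem shows that \<open>m \<mapsto> \<mu>\<^sub>m\<close> is a measurable
  kernel, without which the mixture \<open>\<mu>'\<^sub>M\<close> would not integrate functions as expected. It remains to see
  that the functionals generate all Borel sets of the vague topology
  (\<open>sets_config_borel_eq_laplace_sigma\<close>). This is delicate because a \<open>\<sigma>\<close>-compact metric space need
  not be locally compact, so that the vague topology need not be second countable. However, it is
  coarser than a topology with a countable subbase of measurable sets, which prescribe the number
  of points in a finite union of basic open sets; such conditions localise a configuration because
  configurations are closed and discrete.\<close>

section \<open>A functional monotone class theorem\<close>

lemma polynomial_approx_upper_indicator:
  fixes a :: real
  obtains p :: "nat \<Rightarrow> real \<Rightarrow> real"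
  where "\<And>j. real_polynomial_function (p j)"
    and "\<And>j t. t \<in> {0..1} \<Longrightarrow> \<bar>p j t\<bar> \<le> 2"
    and "\<And>t. t \<in> {0..1} \<Longrightarrow> (\<lambda>j. p j t) \<longlonglongrightarrow> indicator {a<..} t"
proof -
  \<comment> \<open>Ramps of slope \<open>j\<close> converge to the indicator; Weierstrass replaces them by polynomials.\<close>
  define \<phi> where "\<phi> j t = min 1 (max 0 (real j * (t - a)))" for j t
  have "\<exists>g. real_polynomial_function g \<and> (\<forall>t\<in>{0..1}. \<bar>\<phi> j t - g t\<bar> < 1 / Suc j)" for j
  proof -
    have "continuous_on {0..1} (\<phi> j)"
      unfolding \<phi>_def by (intro continuous_intros)
    then show ?thesis
      using Stone_Weierstrass_real_polynomial_function[of "{0..1::real}" "\<phi> j" "1 / Suc j"]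
      by (metis compact_Icc of_nat_0_less_iff zero_less_Suc zero_less_divide_1_iff)
  qed
  then obtain p where p: "\<And>j. real_polynomial_function (p j)"
    "\<And>j t. t \<in> {0..1} \<Longrightarrow> \<bar>\<phi> j t - p j t\<bar> < 1 / Suc j"
    by metis
  show ?thesis
  proof
    show "real_polynomial_function (p j)" for j by (rule p)
    show "\<bar>p j t\<bar> \<le> 2" if "t \<in> {0..1}" for j t
    proof -
      have "1 / real (Suc j) \<le> 1" by simp
      moreover have "0 \<le> \<phi> j t" "\<phi> j t \<le> 1" by (auto simp: \<phi>_def)
      ultimately show ?thesis using p(2)[OF that, of j] by linarith
    qed
    show "(\<lambda>j. p j t) \<longlonglongrightarrow> indicator {a<..} t" if t: "t \<in> {0..1}" for t
    proof -
      have "(\<lambda>j. \<phi> j t) \<longlonglongrightarrow> indicator {a<..} t"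
      proof (cases "a < t")
        case True
        obtain N where N: "1 < real N * (t - a)"
          using reals_Archimedean3[of "t - a"] True by auto
        have "\<phi> j t = 1" if "N \<le> j" for j
        proof -
          have "real N * (t - a) \<le> real j * (t - a)"
            using that True by (intro mult_right_mono) auto
          then show ?thesis using N by (auto simp: \<phi>_def)
        qed
        then show ?thesis using True
          by (intro tendsto_eventually) (auto simp: eventually_sequentially)
      next
        case False
        then have "\<phi> j t = 0" for j
          using mult_nonneg_nonpos[of "real j" "t - a"] by (simp add: \<phi>_def)
        then show ?thesis using False by simp
      qed
      moreover have "(\<lambda>j. \<phi> j t - p j t) \<longlonglongrightarrow> 0"
      proof (rule Lim_null_comparison)
        show "\<forall>\<^sub>F j in sequentially. norm (\<phi> j t - p j t) \<le> 1 / real (Suc j)"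
          using p(2)[OF t] by (auto intro!: always_eventually less_imp_le)
        show "(\<lambda>j. 1 / real (Suc j)) \<longlonglongrightarrow> 0"
          using LIMSEQ_inverse_real_of_nat by (simp add: inverse_eq_divide)
      qed
      ultimately have "(\<lambda>j. \<phi> j t - (\<phi> j t - p j t)) \<longlonglongrightarrow> indicator {a<..} t - 0"
        by (rule tendsto_diff)
      then show ?thesis by simp
    qed
  qed
qed

text \<open>Bounded Borel functions of the \<open>X \<in> H\<close> are limits of polynomials in them, and polynomials stay
  in the span of \<open>H\<close> because \<open>H\<close> is multiplicative. Hence the indicators of the finite intersections
  of generators \<open>{a < X}\<close> satisfy \<open>V\<close>, Dynkin's \<open>\<pi>\<close>-\<open>\<lambda>\<close> theorem extends this to all indicators, and monotone
  limits of simple functions do the rest.\<close>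

lemma functional_monotone_class:
  fixes V :: "('a \<Rightarrow> real) \<Rightarrow> bool" and H :: "('a \<Rightarrow> real) set"
  assumes H01: "\<And>X w. X \<in> H \<Longrightarrow> w \<in> space M \<Longrightarrow> X w \<in> {0..1}"
    and H_mult: "\<And>X Y. X \<in> H \<Longrightarrow> Y \<in> H \<Longrightarrow> (\<lambda>w. X w * Y w) \<in> H"
    and H_one: "(\<lambda>_. 1) \<in> H"
    and H_V: "\<And>X. X \<in> H \<Longrightarrow> V X"
    and V_add: "\<And>Y Z. V Y \<Longrightarrow> V Z \<Longrightarrow> V (\<lambda>w. Y w + Z w)"
    and V_scale: "\<And>c Z. V Z \<Longrightarrow> V (\<lambda>w. c * Z w)"
    and V_lim: "\<And>Z Z' B. (\<And>n. V (Z n)) \<Longrightarrow> (\<And>n w. w \<in> space M \<Longrightarrow> \<bar>Z n w\<bar> \<le> B) \<Longrightarrow>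
      (\<And>w. w \<in> space M \<Longrightarrow> (\<lambda>n::nat. Z n w) \<longlonglongrightarrow> Z' w) \<Longrightarrow> V Z'"
    and gen: "sets M = sigma_sets (space M) {{w \<in> space M. a < X w} | X a. X \<in> H}"
    and F: "F \<in> borel_measurable M" and bounded: "\<And>w. w \<in> space M \<Longrightarrow> \<bar>F w\<bar> \<le> B"
  shows "V F"
proof -
  have V_cong: "V Z'" if "V Z" "\<And>w. w \<in> space M \<Longrightarrow> Z w = Z' w"
    "\<And>w. w \<in> space M \<Longrightarrow> \<bar>Z w\<bar> \<le> C" for Z Z' C
    by (rule V_lim[of "\<lambda>_. Z" C]) (use that in auto)
  have V_zero: "V (\<lambda>_. 0)"
    using V_scale[OF H_V[OF H_one], of 0] by simp
  have V_sum: "V (\<lambda>w. \<Sum>i\<in>I. Z i w)" if "finite I" "\<And>i. i \<in> I \<Longrightarrow> V (Z i)"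
    for I and Z :: "nat \<Rightarrow> 'a \<Rightarrow> real"
    using that by (induction I) (auto simp: V_zero intro: V_add)
  have H_pow: "(\<lambda>w. X w ^ n * Y w) \<in> H" if "X \<in> H" "Y \<in> H" for X Y n
  proof (induction n)
    case 0
    then show ?case using that by simp
  next
    case (Suc n)
    then show ?case using H_mult[OF that(1) Suc] by (simp add: mult.assoc)
  qed
  define U where "U I = {w \<in> space M. \<forall>(X, a)\<in>I. a < X w}" for I :: "(('a \<Rightarrow> real) \<times> real) set"
  \<comment> \<open>The factor \<open>Y\<close> keeps the induction on the number of factors going: it absorbs the powers
    of \<open>X\<close> that the polynomial approximation of the last factor produces.\<close>
  have U: "\<forall>Y\<in>H. V (\<lambda>w. indicator (U I) w * Y w)" if "finite I" "I \<subseteq> H \<times> UNIV" for I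
    using that
  proof (induction I)
    case empty
    show ?case
    proof
      fix Y assume "Y \<in> H"
      then show "V (\<lambda>w. indicator (U {}) w * Y w)"
        using H01 by (intro V_cong[of Y _ 1, OF H_V]) (auto simp: U_def)
    qed
  next
    case (insert i I)
    obtain X a where i: "i = (X, a)" and X: "X \<in> H"
      using insert by (cases i) auto
    obtain p where p: "\<And>j. real_polynomial_function (p j)"
      "\<And>j t. t \<in> {0..1} \<Longrightarrow> \<bar>p j t\<bar> \<le> 2"
      "\<And>t. t \<in> {0..1} \<Longrightarrow> (\<lambda>j. p j t) \<longlonglongrightarrow> indicator {a<..} t"
      using polynomial_approx_upper_indicator[of a] by metis
    show ?case
    proof
      fix Y assume Y: "Y \<in> H"
      show "V (\<lambda>w. indicator (U (insert i I)) w * Y w)"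
      proof (rule V_lim[of "\<lambda>j w. indicator (U I) w * (p j (X w) * Y w)" 2])
        fix j
        obtain c n where c: "p j = (\<lambda>x. \<Sum>k\<le>n. c k * x ^ k)"
          using p(1)[of j] unfolding real_polynomial_function_iff_sum by blast
        have "V (\<lambda>w. \<Sum>k\<le>n. c k * (indicator (U I) w * (X w ^ k * Y w)))"
          using insert H_pow[OF X Y] by (intro V_sum V_scale) auto
        then show "V (\<lambda>w. indicator (U I) w * (p j (X w) * Y w))"
          by (simp add: c sum_distrib_left sum_distrib_right mult_ac)
        show "\<bar>indicator (U I) w * (p j (X w) * Y w)\<bar> \<le> 2" if w: "w \<in> space M" for w
        proof -
          have "\<bar>p j (X w) * Y w\<bar> \<le> 2 * 1"
            unfolding abs_mult using p(2)[OF H01[OF X w]] H01[OF Y w] by (intro mult_mono) auto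
          then show ?thesis by (auto simp: indicator_def)
        qed
      next
        fix w assume w: "w \<in> space M"
        have "(\<lambda>j. indicator (U I) w * (p j (X w) * Y w))
          \<longlonglongrightarrow> indicator (U I) w * (indicator {a<..} (X w) * Y w)"
          by (intro tendsto_intros p(3) H01 X w)
        also have "indicator (U I) w * (indicator {a<..} (X w) * Y w)
          = indicator (U (insert i I)) w * Y w"
          using w by (auto simp: U_def i indicator_def)
        finally show "(\<lambda>j. indicator (U I) w * (p j (X w) * Y w))
          \<longlonglongrightarrow> indicator (U (insert i I)) w * Y w" .
      qed
    qed
  qed
  define G where "G = {U I | I. finite I \<and> I \<subseteq> H \<times> UNIV}"
  have Int_stable: "Int_stable G"
  proof (rule Int_stableI)
    fix A B assume "A \<in> G" "B \<in> G"
    then obtain I J where IJ: "A = U I" "B = U J" "finite I" "finite J" "I \<subseteq> H \<times> UNIV" "J \<subseteq> H \<times> UNIV"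
      unfolding G_def by blast
    moreover have "U I \<inter> U J = U (I \<union> J)" by (auto simp: U_def)
    ultimately show "A \<inter> B \<in> G" unfolding G_def by (auto intro!: exI[of _ "I \<union> J"])
  qed
  have G_sub: "G \<subseteq> Pow (space M)" by (auto simp: G_def U_def)
  have sets_G: "sets M \<subseteq> sigma_sets (space M) G"
    unfolding gen
  proof (rule sigma_sets_mono', safe)
    fix X a assume "X \<in> H"
    then show "{w \<in> space M. a < X w} \<in> G"
      unfolding G_def by (intro CollectI exI[of _ "{(X, a)}"]) (auto simp: U_def)
  qed
  have V_ind: "V (indicator A)" if "A \<in> sets M" for A
  proof -
    have "A \<in> sigma_sets (space M) G" using that sets_G by blast
    with Int_stable G_sub show ?thesis
    proof (induction rule: sigma_sets_induct_disjoint)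
      case (basic A)
      then obtain I where I: "A = U I" "finite I" "I \<subseteq> H \<times> UNIV" unfolding G_def by blast
      then show ?case using U[OF I(2,3)] H_one by auto
    next
      case empty
      show ?case by (rule V_cong[OF V_zero, of _ 0]) auto
    next
      case (compl A)
      have "V (\<lambda>w. 1 + (-1) * indicator A w)"
        by (rule V_add[OF H_V[OF H_one] V_scale[OF compl(2)]])
      then show ?case
        by (rule V_cong[of _ _ 1]) (auto simp: indicator_def)
    next
      case (union A)
      show ?case
      proof (rule V_lim[of "\<lambda>n w. \<Sum>i<n. indicator (A i) w" 1])
        show "V (\<lambda>w. \<Sum>i<n. indicator (A i) w)" for n
          using union by (intro V_sum) auto
        have eq: "(\<Sum>i<n. indicator (A i) w) = (indicator (\<Union>i<n. A i) w :: real)" for n w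
          using union(1) by (intro indicator_UN_disjoint[symmetric])
            (auto simp: disjoint_family_on_def)
        show "\<bar>\<Sum>i<n. indicator (A i) w\<bar> \<le> (1::real)" for n w
          unfolding eq by simp
        show "(\<lambda>n. \<Sum>i<n. indicator (A i) w) \<longlonglongrightarrow> (indicator (\<Union>i. A i) w :: real)" for w
          unfolding eq by (rule LIMSEQ_indicator_UN)
      qed
    qed
  qed
  \<comment> \<open>The shift by \<open>B\<close> makes the function nonnegative, as the induction rule requires.\<close>
  define G where "G w = (if w \<in> space M then F w + B else 0)" for w
  have G_meas: "G \<in> borel_measurable M"
    unfolding G_def using F by measurable
  have G0: "0 \<le> G w" for w
    using bounded[of w] by (auto simp: G_def)
  have "(\<exists>C. \<forall>w\<in>space M. G w \<le> C) \<longrightarrow> V G"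
    using G_meas G0
  proof (induction rule: borel_measurable_induct_real)
    case (set A)
    then show ?case using V_ind by auto
  next
    case (mult u c)
    show ?case
    proof (intro impI, elim exE)
      fix C assume C: "\<forall>w\<in>space M. c * u w \<le> C"
      show "V (\<lambda>w. c * u w)"
      proof (cases "c = 0")
        case True
        then show ?thesis using V_zero by simp
      next
        case False
        then have "\<forall>w\<in>space M. u w \<le> C / c"
          using C mult(1) by (auto simp: field_simps)
        then show ?thesis using mult V_scale by blast
      qed
    qed
  next
    case (add u v)
    show ?case
    proof (intro impI, elim exE)
      fix C assume C: "\<forall>w\<in>space M. v w + u w \<le> C"
      have "u w \<le> C" "v w \<le> C" if "w \<in> space M" for w
        using bspec[OF C that] add(2)[of w] add(4)[of w] by linarith+
      then show "V (\<lambda>w. v w + u w)" using add V_add by blast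
    qed
  next
    case (seq Z)
    show ?case
    proof (intro impI, elim exE)
      fix C assume C: "\<forall>w\<in>space M. G w \<le> C"
      have le: "Z n w \<le> C" if w: "w \<in> space M" for n w
      proof -
        have "incseq (\<lambda>i. Z i w)" using seq(3) by (auto simp: incseq_def le_fun_def)
        then have "Z n w \<le> G w" using seq(4)[OF w] by (rule incseq_le)
        then show ?thesis using C w by force
      qed
      show "V G"
      proof (rule V_lim[of Z C])
        show "V (Z n)" for n using seq(5)[of n] le by blast
        show "\<bar>Z n w\<bar> \<le> C" if "w \<in> space M" for n w
          using le[OF that] seq(2)[of n w] by simp
      qed (rule seq(4))
    qed
  qed
  moreover have "\<forall>w\<in>space M. G w \<le> 2 * B"
    using bounded by (fastforce simp: G_def)
  ultimately have "V G" by blast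
  then have "V (\<lambda>w. G w + (-B) * 1)"
    by (rule V_add[OF _ V_scale[OF H_V[OF H_one]]])
  then show ?thesis
    by (rule V_cong[of _ _ B]) (use bounded in \<open>auto simp: G_def\<close>)
qed

section \<open>Continuous functions with compact support\<close>

lemma compactly_supportedI:
  fixes f :: "'a::metric_space \<Rightarrow> real"
  assumes "continuous_on UNIV f" "compact K" "\<And>x. f x \<noteq> 0 \<Longrightarrow> x \<in> K"
  shows "f \<in> compactly_supported"
proof -
  have "closure (support_on UNIV f) \<subseteq> K"
    using assms by (intro closure_minimal compact_imp_closed) (auto simp: support_on_def)
  then have "compact (closure (support_on UNIV f))"
    using assms(2) by (metis closed_closure compact_Int_closed inf.absorb_iff2)
  then show ?thesis using assms(1) by (simp add: compactly_supported_def)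
qed

lemma compactly_supportedE:
  fixes f :: "'a::metric_space \<Rightarrow> real"
  assumes "f \<in> compactly_supported"
  obtains K where "compact K" "\<And>x. f x \<noteq> 0 \<Longrightarrow> x \<in> K"
proof
  show "compact (closure (support_on UNIV f))"
    using assms by (simp add: compactly_supported_def)
  show "x \<in> closure (support_on UNIV f)" if "f x \<noteq> 0" for x
    using that closure_subset[of "support_on UNIV f"] by (auto simp: support_on_def)
qed

lemma compactly_supported_continuous: "f \<in> compactly_supported \<Longrightarrow> continuous_on UNIV f"
  by (simp add: compactly_supported_def)

lemma compactly_supported_borel [measurable_dest]:
  "f \<in> compactly_supported \<Longrightarrow> f \<in> borel_measurable borel"
  by (simp add: borel_measurable_continuous_onI compactly_supported_continuous)

lemma compactly_supported_bounded:
  fixes f :: "'a::metric_space \<Rightarrow> real"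
  assumes "f \<in> compactly_supported"
  obtains B where "0 \<le> B" "\<And>x. \<bar>f x\<bar> \<le> B"
proof -
  obtain K where K: "compact K" "\<And>x. f x \<noteq> 0 \<Longrightarrow> x \<in> K"
    using compactly_supportedE[OF assms] by blast
  have "compact (f ` K)"
    using compactly_supported_continuous[OF assms] K(1)
    by (meson compact_continuous_image continuous_on_subset subset_UNIV)
  then obtain B where B: "\<And>y. y \<in> f ` K \<Longrightarrow> \<bar>y\<bar> \<le> B"
    using compact_imp_bounded bounded_real by metis
  show ?thesis
  proof (rule that[of "max B 0"])
    show "\<bar>f x\<bar> \<le> max B 0" for x
      using B[of "f x"] K(2)[of x] by (cases "f x = 0") auto
  qed simp
qed

lemma compactly_supported_compose:
  fixes f :: "'a::metric_space \<Rightarrow> real"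
  assumes "f \<in> compactly_supported" "continuous_on UNIV \<phi>" "\<phi> 0 = 0"
  shows "(\<lambda>x. \<phi> (f x)) \<in> compactly_supported"
proof -
  obtain K where K: "compact K" "\<And>x. f x \<noteq> 0 \<Longrightarrow> x \<in> K"
    using compactly_supportedE[OF assms(1)] by blast
  show ?thesis
  proof (rule compactly_supportedI[OF _ K(1)])
    show "continuous_on UNIV (\<lambda>x. \<phi> (f x))"
      by (rule continuous_on_compose2[OF assms(2) compactly_supported_continuous[OF assms(1)]]) auto
    show "x \<in> K" if "\<phi> (f x) \<noteq> 0" for x
      using that assms(3) K(2)[of x] by metis
  qed
qed

lemma compactly_supported_add:
  fixes f :: "'a::metric_space \<Rightarrow> real"
  assumes f: "f \<in> compactly_supported" and g: "g \<in> compactly_supported"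
  shows "(\<lambda>x. f x + g x) \<in> compactly_supported"
proof -
  obtain K where K: "compact K" "\<And>x. f x \<noteq> 0 \<Longrightarrow> x \<in> K"
    using compactly_supportedE[OF f] by blast
  obtain J where J: "compact J" "\<And>x. g x \<noteq> 0 \<Longrightarrow> x \<in> J"
    using compactly_supportedE[OF g] by blast
  show ?thesis
  proof (rule compactly_supportedI)
    show "continuous_on UNIV (\<lambda>x. f x + g x)"
      using f g by (intro continuous_intros compactly_supported_continuous)
    show "compact (K \<union> J)" using K J by blast
    show "x \<in> K \<union> J" if "f x + g x \<noteq> 0" for x
      using that K(2)[of x] J(2)[of x] by (cases "f x = 0") auto
  qed
qed

lemma compactly_supported_zero: "(\<lambda>_. 0) \<in> (compactly_supported :: ('a::metric_space \<Rightarrow> real) set)"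
  by (rule compactly_supportedI[of _ "{}"]) auto

text \<open>The points that have a compact neighbourhood. Test functions vanish at all other points, so the
  vague topology cannot see what a configuration does there.\<close>

definition compact_part :: "'a::metric_space set" where
  "compact_part = \<Union>{V. open V \<and> (\<exists>K. compact K \<and> V \<subseteq> K)}"

lemma compactly_supported_imp_compact_part:
  fixes f :: "'a::metric_space \<Rightarrow> real"
  assumes f: "f \<in> compactly_supported" and x: "f x \<noteq> 0"
  shows "x \<in> compact_part"
proof -
  obtain K where K: "compact K" "\<And>x. f x \<noteq> 0 \<Longrightarrow> x \<in> K"
    using compactly_supportedE[OF f] by blast
  have "open {x. f x \<noteq> 0}"
    using open_Collect_neq[OF compactly_supported_continuous[OF f] continuous_on_const] by simp
  with K x show ?thesis unfolding compact_part_def by (intro UnionI[of "{x. f x \<noteq> 0}"]) auto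
qed

lemma open_compact_part: "open compact_part"
  unfolding compact_part_def by auto

section \<open>Configurations and their integrals\<close>

lemma config_finite_Int: "\<omega> \<in> configurations \<Longrightarrow> compact K \<Longrightarrow> finite (\<omega> \<inter> K)"
  by (simp add: configurations_def)

lemma configurations_insert: "\<omega> \<in> configurations \<Longrightarrow> insert x \<omega> \<in> configurations"
  by (simp add: configurations_def Int_insert_left)

text \<open>A sequence of points of \<open>\<omega>\<close> converging to \<open>x\<close> forms, together with \<open>x\<close>, a compact set that meets
  \<open>\<omega>\<close> in infinitely many points. Thus configurations are closed and discrete even where the space is
  not locally compact.\<close>

lemma configurations_no_limit_point:
  fixes \<omega> :: "'a::metric_space set"
  assumes "\<omega> \<in> configurations"
  shows "\<not> x islimpt \<omega>"
proof
  assume "x islimpt \<omega>"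
  then obtain f where f: "\<And>n::nat. f n \<in> \<omega> - {x}" "f \<longlonglongrightarrow> x"
    unfolding islimpt_sequential by blast
  have "compact (insert x (range f))"
    using compactin_sequence_with_limit[of euclidean f x "range f"] f(2) by simp
  then have "finite (\<omega> \<inter> insert x (range f))"
    using assms by (rule config_finite_Int[rotated])
  then have "finite (range f)"
    by (rule finite_subset[rotated]) (use f in auto)
  then have "closed (range f)" by (rule finite_imp_closed)
  then have "x \<in> range f" by (rule closed_sequentially[OF _ _ f(2)]) auto
  then show False using f(1) by auto
qed

lemma configuration_isolating_ball:
  fixes \<omega> :: "'a::metric_space set"
  assumes "\<omega> \<in> configurations"
  obtains e where "0 < e" "\<omega> \<inter> ball x e \<subseteq> {x}"
  using configurations_no_limit_point[OF assms, of x] unfolding islimpt_approachable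
  by (metis (no_types, lifting) IntE mem_ball dist_commute singleton_iff subsetI)

lemma sets_config_measure [simp, measurable_cong]: "sets (config_measure \<omega>) = sets borel"
  by (simp add: config_measure_def)

lemma emeasure_config_measure:
  fixes \<omega> :: "'a::metric_space set"
  assumes "A \<in> sets borel"
  shows "emeasure (config_measure \<omega>) A = emeasure (count_space \<omega>) (A \<inter> \<omega>)"
  using assms by (simp add: config_measure_def emeasure_distr)

lemma emeasure_config_eq_of_nat:
  fixes \<omega> :: "'a::metric_space set"
  assumes "A \<in> sets borel"
  shows "emeasure (config_measure \<omega>) A = of_nat k \<longleftrightarrow> finite (\<omega> \<inter> A) \<and> card (\<omega> \<inter> A) = k"
  using assms by (simp add: emeasure_config_measure emeasure_count_space Int_commute)

lemma emeasure_config_ge_1: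
  fixes \<omega> :: "'a::metric_space set"
  assumes "A \<in> sets borel"
  shows "1 \<le> emeasure (config_measure \<omega>) A \<longleftrightarrow> \<omega> \<inter> A \<noteq> {}"
proof -
  have "1 \<le> card (\<omega> \<inter> A) \<longleftrightarrow> \<omega> \<inter> A \<noteq> {}" if "finite (\<omega> \<inter> A)"
    using that by (simp add: Suc_le_eq card_gt_0_iff)
  moreover have "(1::ennreal) \<le> of_nat n \<longleftrightarrow> 1 \<le> n" for n
    by (metis of_nat_1 of_nat_le_iff)
  ultimately show ?thesis using assms
    by (auto simp: emeasure_config_measure emeasure_count_space Int_commute)
qed

lemma integral_config_measure:
  fixes f :: "'a::metric_space \<Rightarrow> real"
  assumes f: "f \<in> compactly_supported" and A: "finite A" "{x \<in> \<omega>. f x \<noteq> 0} \<subseteq> A" "A \<subseteq> \<omega>"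
  shows "(\<integral>x. f x \<partial>config_measure \<omega>) = (\<Sum>x\<in>A. f x)"
proof -
  have fin: "finite {x \<in> \<omega>. f x \<noteq> 0}" using A finite_subset by blast
  have "(\<integral>x. f x \<partial>config_measure \<omega>) = (\<integral>x. f x \<partial>count_space \<omega>)"
    unfolding config_measure_def using compactly_supported_borel[OF f]
    by (subst integral_distr) auto
  also have "\<dots> = (\<Sum>x | x \<in> \<omega> \<and> f x \<noteq> 0. f x)"
    by (rule lebesgue_integral_count_space_finite_support[OF fin])
  also have "\<dots> = (\<Sum>x\<in>A. f x)"
    using A by (intro sum.mono_neutral_left) auto
  finally show ?thesis .
qed

lemma config_support_finite:
  fixes f :: "'a::metric_space \<Rightarrow> real"
  assumes \<omega>: "\<omega> \<in> configurations" and f: "f \<in> compactly_supported"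
  shows "finite {x \<in> \<omega>. f x \<noteq> 0}"
proof -
  obtain K where K: "compact K" "\<And>x. f x \<noteq> 0 \<Longrightarrow> x \<in> K"
    using compactly_supportedE[OF f] by blast
  show ?thesis
    by (rule finite_subset[OF _ config_finite_Int[OF \<omega> K(1)]]) (use K in auto)
qed

lemma integrable_config_measure:
  fixes f :: "'a::metric_space \<Rightarrow> real"
  assumes \<omega>: "\<omega> \<in> configurations" and f: "f \<in> compactly_supported"
  shows "integrable (config_measure \<omega>) f"
proof -
  have "integrable (count_space \<omega>) f"
  proof -
    obtain B where "\<And>x. \<bar>f x\<bar> \<le> B" using compactly_supported_bounded[OF f] by blast
    then show ?thesis
      using config_support_finite[OF assms]
      by (intro integrableI_bounded_set[where A = "{x \<in> \<omega>. f x \<noteq> 0}" and B = B])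
        (auto simp: emeasure_count_space AE_count_space of_nat_less_top)
  qed
  then show ?thesis
    unfolding config_measure_def using compactly_supported_borel[OF f]
    by (subst integrable_distr_eq) auto
qed

lemma integral_config_insert:
  fixes f :: "'a::metric_space \<Rightarrow> real"
  assumes \<omega>: "\<omega> \<in> configurations" and f: "f \<in> compactly_supported" and x: "x \<notin> \<omega>"
  shows "(\<integral>y. f y \<partial>config_measure (insert x \<omega>)) = f x + (\<integral>y. f y \<partial>config_measure \<omega>)"
proof -
  let ?A = "{x \<in> \<omega>. f x \<noteq> 0}"
  have fin: "finite ?A" by (rule config_support_finite[OF \<omega> f])
  have "(\<integral>y. f y \<partial>config_measure (insert x \<omega>)) = (\<Sum>y\<in>insert x ?A. f y)"
    using fin by (intro integral_config_measure[OF f]) auto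
  also have "\<dots> = f x + (\<Sum>y\<in>?A. f y)" using fin x by simp
  also have "(\<Sum>y\<in>?A. f y) = (\<integral>y. f y \<partial>config_measure \<omega>)"
    using fin by (intro integral_config_measure[OF f, symmetric]) auto
  finally show ?thesis .
qed

section \<open>Open sets in a sigma-compact metric space\<close>

lemma sigma_compact_countable_ball_base:
  assumes "sigma_compact (UNIV :: 'a::metric_space set)"
  obtains \<B> :: "'a::metric_space set set" where "countable \<B>" "\<And>V. V \<in> \<B> \<Longrightarrow> open V"
    "\<And>U x. open U \<Longrightarrow> x \<in> U \<Longrightarrow> \<exists>V\<in>\<B>. x \<in> V \<and> V \<subseteq> U"
proof -
  obtain \<C> :: "'a set set" where \<C>: "countable \<C>" "\<And>K. K \<in> \<C> \<Longrightarrow> compact K" "\<Union>\<C> = UNIV"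
    using assms unfolding sigma_compact_def by blast
  have "\<exists>F. finite F \<and> K \<subseteq> (\<Union>d\<in>F. ball d (1 / Suc n))" if "K \<in> \<C>" for K n
    using compactE_image[OF \<C>(2)[OF that], of K "\<lambda>d. ball d (1 / Suc n)"]
    by (metis UN_I centre_in_ball of_nat_0_less_iff open_ball subsetI zero_less_Suc zero_less_divide_1_iff)
  then obtain F where F: "\<And>K n. K \<in> \<C> \<Longrightarrow> finite (F K n)"
    "\<And>K n. K \<in> \<C> \<Longrightarrow> K \<subseteq> (\<Union>d\<in>F K n. ball d (1 / Suc n))"
    by metis
  define \<B> where "\<B> = (\<Union>K\<in>\<C>. \<Union>n. (\<lambda>d. ball d (1 / Suc n)) ` F K n)"
  show ?thesis
  proof
    show "countable \<B>"
      unfolding \<B>_def using \<C>(1) F(1)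
      by (simp add: countable_finite)
    show "open V" if "V \<in> \<B>" for V using that by (auto simp: \<B>_def)
    fix U and x :: 'a assume U: "open U" "x \<in> U"
    then obtain e where e: "0 < e" "ball x e \<subseteq> U" using open_contains_ball by blast
    obtain n where n: "inverse (real (Suc n)) < e / 2"
      using reals_Archimedean[of "e / 2"] e by auto
    obtain K where K: "K \<in> \<C>" "x \<in> K" using \<C>(3) by blast
    then obtain d where d: "d \<in> F K n" "dist d x < 1 / Suc n" using F(2)[of K n] by auto
    have "ball d (1 / Suc n) \<subseteq> ball x e"
    proof
      fix y assume "y \<in> ball d (1 / Suc n)"
      then have "dist x y < e"
        using d(2) n dist_triangle_half_l[of x d e y] dist_commute
        by (metis inverse_eq_divide dist_commute less_trans mem_ball dist_triangle_half_r)
      then show "y \<in> ball x e" by simp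
    qed
    moreover have "ball d (1 / Suc n) \<in> \<B>" using K d by (auto simp: \<B>_def)
    ultimately show "\<exists>V\<in>\<B>. x \<in> V \<and> V \<subseteq> U" using e d by (intro bexI) auto
  qed
qed

lemma compactly_supported_positive_on_open:
  fixes V :: "'a::metric_space set"
  assumes V: "open V" "V \<subseteq> K" and K: "compact K"
  obtains t where "t \<in> compactly_supported" "\<And>x. 0 \<le> t x" "\<And>x. 0 < t x \<longleftrightarrow> x \<in> V"
proof (cases "V = UNIV")
  case True
  then have K': "K = UNIV" using V by auto
  show ?thesis
  proof (rule that[of "\<lambda>_. 1"])
    show "(\<lambda>_::'a. 1) \<in> compactly_supported"
      by (rule compactly_supportedI[OF _ K]) (auto simp: K')
  qed (use True in auto)
next
  case False
  have pos: "0 < infdist x (- V) \<longleftrightarrow> x \<in> V" for x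
  proof -
    have "closed (- V)" "- V \<noteq> {}" using V False by auto
    then have "infdist x (- V) = 0 \<longleftrightarrow> x \<in> - V"
      by (metis in_closure_iff_infdist_zero closure_closed)
    then show ?thesis using infdist_nonneg[of x "- V"] by auto
  qed
  show ?thesis
  proof (rule that[of "\<lambda>x. infdist x (- V)"])
    show "(\<lambda>x. infdist x (- V)) \<in> compactly_supported"
    proof (rule compactly_supportedI[OF _ K])
      show "continuous_on UNIV (\<lambda>x. infdist x (- V))" by (intro continuous_intros)
      show "x \<in> K" if "infdist x (- V) \<noteq> 0" for x
        using that pos[of x] infdist_nonneg[of x "- V"] V(2) by auto
    qed
  qed (use pos in \<open>auto simp: infdist_nonneg\<close>)
qed

text \<open>The open set is a countable union of basic sets contained in compact sets. Summing functions that
  are positive exactly on the first \<open>n\<close> of them, multiplying by \<open>n\<close> and truncating at 1 gives the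
  approximation.\<close>

lemma compactly_supported_approx_indicator:
  assumes \<sigma>: "sigma_compact (UNIV :: 'a::metric_space set)"
    and A: "open A" "A \<subseteq> (compact_part :: 'a::metric_space set)"
  obtains f :: "nat \<Rightarrow> 'a::metric_space \<Rightarrow> real" where "\<And>n. f n \<in> compactly_supported"
    "\<And>n x. 0 \<le> f n x" "\<And>x. incseq (\<lambda>n. f n x)" "\<And>x. (\<lambda>n. f n x) \<longlonglongrightarrow> indicator A x"
proof -
  obtain \<B> :: "'a set set" where \<B>: "countable \<B>" "\<And>V. V \<in> \<B> \<Longrightarrow> open V"
    "\<And>U x. open U \<Longrightarrow> x \<in> U \<Longrightarrow> \<exists>V\<in>\<B>. x \<in> V \<and> V \<subseteq> U"
    using sigma_compact_countable_ball_base[OF \<sigma>] by metis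
  define \<G> where "\<G> = {V \<in> \<B>. V \<subseteq> A \<and> (\<exists>K. compact K \<and> V \<subseteq> K)}"
  have \<G>_count: "countable \<G>" using \<B>(1) by (auto simp: \<G>_def)
  have \<G>_cover: "\<exists>V\<in>\<G>. x \<in> V" if "x \<in> A" for x
  proof -
    obtain W K where W: "open W" "compact K" "W \<subseteq> K" "x \<in> W"
      using A \<open>x \<in> A\<close> unfolding compact_part_def by blast
    obtain V where "V \<in> \<B>" "x \<in> V" "V \<subseteq> A \<inter> W"
      using \<B>(3)[of "A \<inter> W" x] A W \<open>x \<in> A\<close> by blast
    moreover have "V \<in> \<G>" using calculation W unfolding \<G>_def by blast
    ultimately show ?thesis by blast
  qed
  show ?thesis
  proof (cases "\<G> = {}")
    case True
    then have "A = {}" using \<G>_cover by blast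
    then show ?thesis
      by (intro that[of "\<lambda>_ _. 0"]) (auto simp: compactly_supported_zero incseq_def)
  next
    case False
    have "\<exists>t. t \<in> compactly_supported \<and> (\<forall>x. 0 \<le> t x) \<and> (\<forall>x. 0 < t x \<longleftrightarrow> x \<in> V)"
      if "V \<in> \<G>" for V
      using that \<B>(2) compactly_supported_positive_on_open unfolding \<G>_def
      by (smt (verit) mem_Collect_eq)
    then obtain t where t: "\<And>V. V \<in> \<G> \<Longrightarrow> t V \<in> compactly_supported"
      "\<And>V x. V \<in> \<G> \<Longrightarrow> 0 \<le> t V x" "\<And>V x. V \<in> \<G> \<Longrightarrow> 0 < t V x \<longleftrightarrow> x \<in> V"
      by metis
    define G where "G = from_nat_into \<G>"
    have G: "G i \<in> \<G>" for i unfolding G_def by (rule from_nat_into[OF False])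
    have G_surj: "\<exists>i. V = G i" if "V \<in> \<G>" for V
      using that from_nat_into_surj[OF \<G>_count] unfolding G_def by metis
    define s where "s n x = (\<Sum>i<n. t (G i) x)" for n x
    define f where "f n x = min 1 (real n * s n x)" for n x
    have s0: "0 \<le> s n x" for n x unfolding s_def using t(2) G by (simp add: sum_nonneg)
    have s_mono: "s m x \<le> s n x" if "m \<le> n" for m n x
      unfolding s_def using t(2) G that by (intro sum_mono2) auto
    show ?thesis
    proof (rule that[of f])
      show "f n \<in> compactly_supported" for n
      proof -
        have "(\<lambda>x. s m x) \<in> compactly_supported" for m
          unfolding s_def
          by (induction m) (auto simp: compactly_supported_zero t G intro!: compactly_supported_add)
        then have "(\<lambda>x. min 1 (real n * s n x)) \<in> compactly_supported"
          by (rule compactly_supported_compose[where \<phi> = "\<lambda>u. min 1 (real n * u)"])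
            (auto intro!: continuous_intros)
        then show ?thesis by (simp add: f_def[abs_def])
      qed
      show "0 \<le> f n x" for n x using s0 by (simp add: f_def)
      show "incseq (\<lambda>n. f n x)" for x
      proof (unfold incseq_def, intro allI impI)
        fix m n :: nat assume mn: "m \<le> n"
        have "real m * s m x \<le> real n * s n x"
          using mn s_mono[OF mn] s0 by (intro mult_mono) auto
        then show "f m x \<le> f n x" by (simp add: f_def)
      qed
      show "(\<lambda>n. f n x) \<longlonglongrightarrow> indicator A x" for x
      proof (cases "x \<in> A")
        case True
        then obtain i where i: "x \<in> G i" using \<G>_cover G_surj by blast
        define c where "c = t (G i) x"
        have c: "0 < c" using t(3)[OF G] i by (simp add: c_def)
        obtain N where N: "1 < real N * c" using reals_Archimedean3[OF c] by auto
        have "f n x = 1" if "max N (Suc i) \<le> n" for n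
        proof -
          have "c \<le> s n x" unfolding s_def c_def
            using that t(2)[OF G] by (intro member_le_sum) auto
          then have "real N * c \<le> real n * s n x"
            using that c by (intro mult_mono) auto
          then show ?thesis using N by (simp add: f_def)
        qed
        then show ?thesis using True
          by (intro tendsto_eventually eventually_sequentiallyI[of "max N (Suc i)"]) auto
      next
        case False
        have "t (G i) x = 0" for i
          using False t(2,3)[OF G, where x=x and i1=i] G[of i] by (force simp: \<G>_def)
        then have "f n x = 0" for n by (simp add: f_def s_def)
        then show ?thesis using False by simp
      qed
    qed
  qed
qed

section \<open>The Borel sets of the vague topology\<close>

text \<open>The finite intersections of the subbasic sets form a countable base.\<close>

lemma generate_topology_on_countable_sigma_sets:
  assumes E: "countable E" and U: "generate_topology_on E U"
  shows "U \<in> sigma_sets (\<Union>E) E"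
proof -
  define N where "N = Inter ` {F. finite F \<and> F \<subseteq> E \<and> F \<noteq> {}}"
  have N_iff: "A \<in> N \<longleftrightarrow> (\<exists>F. (finite F \<and> F \<subseteq> E \<and> F \<noteq> {}) \<and> A = \<Inter>F)" for A
    by (simp add: N_def image_iff Bex_def)
  have N_count: "countable N"
    unfolding N_def
    by (intro countable_image countable_subset[OF _ countable_Collect_finite_subset[OF E]]) auto
  have N_Int: "A \<inter> B \<in> N" if "A \<in> N" "B \<in> N" for A B
  proof -
    from that(1)[unfolded N_iff] obtain F where F: "(finite F \<and> F \<subseteq> E \<and> F \<noteq> {}) \<and> A = \<Inter>F" ..
    from that(2)[unfolded N_iff] obtain G where G: "(finite G \<and> G \<subseteq> E \<and> G \<noteq> {}) \<and> B = \<Inter>G" ..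
    have "A \<inter> B = \<Inter>(F \<union> G)" by (simp add: F G Inter_Un_distrib)
    then show ?thesis
      unfolding N_def using F G by (intro image_eqI[of _ _ "F \<union> G"]) auto
  qed
  have N_sets: "A \<in> sets (sigma (\<Union>E) E)" if "A \<in> N" for A
  proof -
    from that[unfolded N_iff] obtain F where F: "(finite F \<and> F \<subseteq> E \<and> F \<noteq> {}) \<and> A = \<Inter>F" ..
    have "(\<Inter>X\<in>F. X) \<in> sets (sigma (\<Union>E) E)"
      using F by (intro sets.finite_INT) (auto simp: sets_measure_of subset_Pow_Union)
    then show ?thesis using F by simp
  qed
  have "\<forall>x\<in>U. \<exists>A\<in>N. x \<in> A \<and> A \<subseteq> U"
    using U
  proof induction
    case (Int a b)
    show ?case
    proof
      fix x assume "x \<in> a \<inter> b"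
      then obtain A B where "A \<in> N" "x \<in> A" "A \<subseteq> a" "B \<in> N" "x \<in> B" "B \<subseteq> b"
        using Int.IH by blast
      then show "\<exists>A\<in>N. x \<in> A \<and> A \<subseteq> a \<inter> b"
        using N_Int by (intro bexI[of _ "A \<inter> B"]) auto
    qed
  next
    case (UN K)
    show ?case using UN.IH by (meson Union_iff Union_upper order_trans)
  next
    case (Basis s)
    have "s \<in> N" unfolding N_def using Basis by (intro image_eqI[of _ _ "{s}"]) auto
    then show ?case by blast
  qed simp
  then have "U = \<Union>{A \<in> N. A \<subseteq> U}" by blast
  also have "\<dots> \<in> sets (sigma (\<Union>E) E)"
    using N_count N_sets by (intro sets.countable_Union) auto
  finally show ?thesis by (simp add: sets_measure_of Sup_upper subset_Pow_Union)
qed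

text \<open>The random variable whose expectation is the Laplace functional at \<open>f\<close>. For nonnegative \<open>f\<close> it takes
  values in the unit interval, which spares all integrability questions.\<close>

definition config_laplace :: "('a::metric_space \<Rightarrow> real) \<Rightarrow> 'a set \<Rightarrow> real" where
  "config_laplace f \<omega> = exp (- (\<integral>x. f x \<partial>config_measure \<omega>))"

definition nonneg_test_functions :: "('a::metric_space \<Rightarrow> real) set" where
  "nonneg_test_functions = {f \<in> compactly_supported. \<forall>x. 0 \<le> f x}"

definition laplace_sigma :: "'a::metric_space set measure" where
  "laplace_sigma = sigma configurations
     {{\<omega> \<in> configurations. a < config_laplace f \<omega>} | f a. f \<in> nonneg_test_functions}"

lemma space_laplace_sigma: "space laplace_sigma = configurations"
  unfolding laplace_sigma_def by (rule space_measure_of) auto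

lemma config_laplace_measurable_laplace_sigma:
  assumes "f \<in> nonneg_test_functions"
  shows "config_laplace f \<in> borel_measurable laplace_sigma"
proof (rule borel_measurableI_greater)
  fix a
  show "{\<omega> \<in> space laplace_sigma. a < config_laplace f \<omega>} \<in> sets laplace_sigma"
    unfolding space_laplace_sigma unfolding laplace_sigma_def
    using assms by (auto intro!: in_measure_of)
qed

text \<open>The number of points in \<open>A\<close> is the limit of the integrals of test functions increasing to the
  indicator of \<open>A\<close>.\<close>

lemma emeasure_config_measurable_laplace_sigma:
  fixes A :: "'a::metric_space set"
  assumes \<sigma>: "sigma_compact (UNIV :: 'a set)" and A: "open A" "A \<subseteq> compact_part"
  shows "(\<lambda>\<omega>. emeasure (config_measure \<omega>) A) \<in> borel_measurable laplace_sigma"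
proof -
  obtain f :: "nat \<Rightarrow> 'a \<Rightarrow> real" where f: "\<And>n. f n \<in> compactly_supported"
    "\<And>n x. 0 \<le> f n x" "\<And>x. incseq (\<lambda>n. f n x)" "\<And>x. (\<lambda>n. f n x) \<longlonglongrightarrow> indicator A x"
    using compactly_supported_approx_indicator[OF \<sigma> A] by metis
  have "emeasure (config_measure \<omega>) A = (SUP n. ennreal (- ln (config_laplace (f n) \<omega>)))"
    if \<omega>: "\<omega> \<in> configurations" for \<omega>
  proof -
    have "(SUP n. ennreal (f n x)) = indicator A x" for x
    proof -
      have "(\<lambda>n. ennreal (f n x)) \<longlonglongrightarrow> ennreal (indicator A x)"
        by (intro tendsto_ennrealI f)
      moreover have "(\<lambda>n. ennreal (f n x)) \<longlonglongrightarrow> (SUP n. ennreal (f n x))"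
        using f(3)[of x] by (intro LIMSEQ_SUP) (auto simp: incseq_def intro!: ennreal_leI)
      ultimately show ?thesis using LIMSEQ_unique by (metis ennreal_indicator)
    qed
    then have "emeasure (config_measure \<omega>) A = (\<integral>\<^sup>+x. (SUP n. ennreal (f n x)) \<partial>config_measure \<omega>)"
      using A by simp
    also have "\<dots> = (SUP n. \<integral>\<^sup>+x. ennreal (f n x) \<partial>config_measure \<omega>)"
      using f(3) compactly_supported_borel[OF f(1)]
      by (intro nn_integral_monotone_convergence_SUP)
        (auto simp: incseq_def le_fun_def intro!: ennreal_leI measurable_compose[OF _ measurable_ennreal])
    also have "\<dots> = (SUP n. ennreal (\<integral>x. f n x \<partial>config_measure \<omega>))"
      using f(1,2) integrable_config_measure[OF \<omega>] by (subst nn_integral_eq_integral) auto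
    finally show ?thesis by (simp add: config_laplace_def)
  qed
  moreover have "(\<lambda>\<omega>. SUP n. ennreal (- ln (config_laplace (f n) \<omega>))) \<in> borel_measurable laplace_sigma"
    using f(1,2) config_laplace_measurable_laplace_sigma[of "f _"]
    by (intro borel_measurable_SUP measurable_compose[OF _ measurable_ennreal]
        borel_measurable_uminus borel_measurable_ln) (auto simp: nonneg_test_functions_def)
  ultimately show ?thesis
    by (subst measurable_cong) (auto simp: space_laplace_sigma)
qed

text \<open>Let \<open>S\<close> be a compact set outside of which \<open>f\<close> vanishes. Only the finitely many points of \<open>\<omega>\<close> in
  \<open>S \<inter> compact_part\<close> contribute to \<open>\<integral>f d\<omega>\<close>. Choose disjoint basic neighbourhoods of these points on
  which \<open>f\<close> hardly varies, and finitely many basic sets that cover \<open>S\<close> without catching further points of \<open>\<omega>\<close>.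
  If \<open>\<eta>\<close> has exactly one point in each of the neighbourhoods and in total as many points as \<open>\<omega>\<close> in the union,
  then its points near \<open>S\<close> correspond one to one to those of \<open>\<omega>\<close>, and \<open>\<integral>f d\<eta>\<close> is close to \<open>\<integral>f d\<omega>\<close>. The
  counts are taken inside \<open>compact_part\<close>, where they are measurable.\<close>

lemma vague_basic_open_by_counts:
  fixes f :: "'a::metric_space \<Rightarrow> real" and \<B> :: "'a set set"
  assumes base_open: "\<And>V. V \<in> \<B> \<Longrightarrow> open V"
    and base: "\<And>U x. open U \<Longrightarrow> x \<in> U \<Longrightarrow> \<exists>V\<in>\<B>. x \<in> V \<and> V \<subseteq> U"
    and f: "f \<in> compactly_supported" and U: "open U"
  defines "E \<equiv> {{\<omega> \<in> configurations. emeasure (config_measure \<omega>) (\<Union>F \<inter> compact_part) = of_nat k} | F k.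
      finite F \<and> F \<subseteq> \<B>}"
  shows "openin (topology_generated_by E) {\<omega> \<in> configurations. (\<integral>x. f x \<partial>config_measure \<omega>) \<in> U}"
proof (subst openin_subopen, safe)
  fix \<omega> assume \<omega>: "\<omega> \<in> configurations" and in_U: "(\<integral>x. f x \<partial>config_measure \<omega>) \<in> U"
  obtain S where S: "compact S" "\<And>x. f x \<noteq> 0 \<Longrightarrow> x \<in> S"
    using compactly_supportedE[OF f] by blast
  define G where "G = \<omega> \<inter> S \<inter> compact_part"
  have fin_S: "finite (\<omega> \<inter> S)" by (rule config_finite_Int[OF \<omega> S(1)])
  then have fin_G: "finite G" by (auto simp: G_def)
  obtain \<epsilon> where \<epsilon>: "0 < \<epsilon>" "ball (\<integral>x. f x \<partial>config_measure \<omega>) \<epsilon> \<subseteq> U"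
    using U in_U open_contains_ball by blast
  define \<delta> where "\<delta> = \<epsilon> / (real (card G) + 1)"
  have \<delta>: "0 < \<delta>" "real (card G) * \<delta> < \<epsilon>"
    using \<epsilon>(1) by (auto simp: \<delta>_def field_simps)
  \<comment> \<open>Small neighbourhoods of the points of \<open>\<omega>\<close>; halving the isolation radius makes them disjoint.\<close>
  have "\<exists>V\<in>\<B>. x \<in> V \<and> (\<forall>y\<in>V. \<bar>f y - f x\<bar> < \<delta>) \<and> (\<forall>z\<in>\<omega>. z \<noteq> x \<longrightarrow> (\<forall>y\<in>V. 2 * dist x y < dist x z))"
    for x
  proof -
    obtain e where e: "0 < e" "\<omega> \<inter> ball x e \<subseteq> {x}"
      using configuration_isolating_ball[OF \<omega>] by blast
    have "open ({y. \<bar>f y - f x\<bar> < \<delta>} \<inter> ball x (e / 2))"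
      by (intro open_Int open_ball open_Collect_less continuous_intros
          compactly_supported_continuous[OF f])
    then obtain V where V: "V \<in> \<B>" "x \<in> V" "V \<subseteq> {y. \<bar>f y - f x\<bar> < \<delta>} \<inter> ball x (e / 2)"
      using base[of "{y. \<bar>f y - f x\<bar> < \<delta>} \<inter> ball x (e / 2)" x] e \<delta> by auto
    have "2 * dist x y < dist x z" if "z \<in> \<omega>" "z \<noteq> x" "y \<in> V" for y z
    proof -
      have "dist x y < e / 2" using V(3) that(3) by auto
      moreover have "e \<le> dist x z" using e(2) that(1,2) by (force simp: not_le[symmetric])
      ultimately show ?thesis by linarith
    qed
    then show ?thesis using V by (intro bexI[of _ V]) auto
  qed
  then obtain V where V: "\<And>x. V x \<in> \<B>" "\<And>x. x \<in> V x" "\<And>x y. y \<in> V x \<Longrightarrow> \<bar>f y - f x\<bar> < \<delta>"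
    "\<And>x y z. z \<in> \<omega> \<Longrightarrow> z \<noteq> x \<Longrightarrow> y \<in> V x \<Longrightarrow> 2 * dist x y < dist x z"
    by metis
  have V_Int: "\<omega> \<inter> V x \<subseteq> {x}" for x by (auto dest!: V(4)[of _ x])
  have V_disj: "V x \<inter> V z = {}" if "x \<in> \<omega>" "z \<in> \<omega>" "x \<noteq> z" for x z
  proof (rule ccontr)
    assume "V x \<inter> V z \<noteq> {}"
    then obtain y where y: "y \<in> V x" "y \<in> V z" by blast
    have "2 * dist x y < dist x z" "2 * dist z y < dist z x"
      using V(4)[OF that(2) _ y(1)] V(4)[OF that(1) _ y(2)] that(3) by auto
    then show False using dist_triangle2[of x z y] by (simp add: dist_commute)
  qed
  obtain C where C: "C \<subseteq> S" "finite C" "S \<subseteq> (\<Union>x\<in>C. V x)"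
  proof (rule compactE_image[OF S(1), of S V])
    show "open (V x)" for x by (rule base_open[OF V(1)])
    show "S \<subseteq> (\<Union>x\<in>S. V x)" using V(2) by blast
  qed
  define F where "F = V ` (C \<union> G)"
  have F: "finite F" "F \<subseteq> \<B>" using C(2) fin_G V(1) by (auto simp: F_def)
  have F_open: "open (\<Union>F \<inter> compact_part)"
    using F(2) base_open open_compact_part by (intro open_Int open_Union) auto
  have FG: "\<omega> \<inter> (\<Union>F \<inter> compact_part) = G"
  proof (intro equalityI subsetI)
    fix z assume "z \<in> \<omega> \<inter> (\<Union>F \<inter> compact_part)"
    then obtain x where x: "x \<in> C \<union> G" "z \<in> \<omega> \<inter> V x" "z \<in> compact_part"
      by (auto simp: F_def)
    then have "z = x" using V_Int[of x] by auto
    then show "z \<in> G" using x C(1) by (auto simp: G_def)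
  next
    fix z assume "z \<in> G"
    then show "z \<in> \<omega> \<inter> (\<Union>F \<inter> compact_part)"
      using V(2)[of z] by (auto simp: F_def G_def)
  qed
  define T where "T = {\<eta> \<in> configurations.
      emeasure (config_measure \<eta>) (\<Union>F \<inter> compact_part) = of_nat (card G) \<and>
      (\<forall>x\<in>G. emeasure (config_measure \<eta>) (V x \<inter> compact_part) = of_nat 1)}"
  have V_meas: "V x \<inter> compact_part \<in> sets borel" for x
    using base_open[OF V(1)[of x]] open_compact_part by (intro borel_open open_Int)
  have F_meas: "\<Union>F \<inter> compact_part \<in> sets borel" using F_open by (rule borel_open)
  have \<omega>T: "\<omega> \<in> T"
  proof -
    have "finite (\<omega> \<inter> (V x \<inter> compact_part)) \<and> card (\<omega> \<inter> (V x \<inter> compact_part)) = 1" if "x \<in> G" for x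
    proof -
      have "\<omega> \<inter> (V x \<inter> compact_part) = {x}" using that V_Int V(2) by (auto simp: G_def)
      then show ?thesis by simp
    qed
    then show ?thesis
      unfolding T_def using \<omega> F_meas V_meas fin_G
      by (simp only: mem_Collect_eq emeasure_config_eq_of_nat FG) blast
  qed
  have T_open: "openin (topology_generated_by E) T"
  proof -
    define Q where "Q F k = {\<omega> \<in> configurations.
      emeasure (config_measure \<omega>) (\<Union>F \<inter> compact_part) = of_nat k}" for F :: "'a set set" and k :: nat
    have Q: "openin (topology_generated_by E) (Q F k)" if "finite F" "F \<subseteq> \<B>" for F k
      using that unfolding E_def Q_def by (intro topology_generated_by_Basis) blast
    have "T = \<Inter>(insert (Q F (card G)) ((\<lambda>x. Q {V x} 1) ` G))"
      unfolding T_def Q_def by auto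
    also have "openin (topology_generated_by E) \<dots>"
      using fin_G F V(1) by (intro openin_Inter) (auto intro!: Q)
    finally show ?thesis .
  qed
  have "(\<integral>x. f x \<partial>config_measure \<eta>) \<in> U" if "\<eta> \<in> T" for \<eta>
  proof -
    have \<eta>: "finite (\<eta> \<inter> (\<Union>F \<inter> compact_part))" "card (\<eta> \<inter> (\<Union>F \<inter> compact_part)) = card G"
      "\<And>x. x \<in> G \<Longrightarrow> card (\<eta> \<inter> (V x \<inter> compact_part)) = 1"
      using that F_meas V_meas unfolding T_def mem_Collect_eq
      by (auto simp only: emeasure_config_eq_of_nat)
    have "\<exists>y. y \<in> \<eta> \<inter> (V x \<inter> compact_part)" if "x \<in> G" for x
      using \<eta>(3)[OF that] by (metis card_1_singletonE insertI1)
    then obtain y where y: "\<And>x. x \<in> G \<Longrightarrow> y x \<in> \<eta> \<inter> (V x \<inter> compact_part)" by metis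
    have inj: "inj_on y G"
      by (rule inj_onI) (metis (full_types) IntE IntI V_disj G_def empty_iff y)
    have img: "y ` G = \<eta> \<inter> (\<Union>F \<inter> compact_part)"
    proof (rule card_subset_eq[OF \<eta>(1)])
      show "y ` G \<subseteq> \<eta> \<inter> (\<Union>F \<inter> compact_part)" using y by (auto simp: F_def)
      show "card (y ` G) = card (\<eta> \<inter> (\<Union>F \<inter> compact_part))"
        using card_image[OF inj] \<eta>(2) by simp
    qed
    have nz: "x \<in> \<Union>F \<inter> compact_part" if "f x \<noteq> 0" for x
      using S(2)[OF that] C(3) compactly_supported_imp_compact_part[OF f that] by (auto simp: F_def)
    have "(\<integral>x. f x \<partial>config_measure \<eta>) = (\<Sum>z\<in>y ` G. f z)"
      by (rule integral_config_measure[OF f]) (use \<eta>(1) nz in \<open>auto simp: img\<close>)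
    also have "\<dots> = (\<Sum>x\<in>G. f (y x))" using inj by (simp add: sum.reindex)
    finally have 1: "(\<integral>x. f x \<partial>config_measure \<eta>) = (\<Sum>x\<in>G. f (y x))" .
    have 2: "(\<integral>x. f x \<partial>config_measure \<omega>) = (\<Sum>x\<in>G. f x)"
      by (rule integral_config_measure[OF f fin_G])
        (use S(2) compactly_supported_imp_compact_part[OF f] in \<open>auto simp: G_def\<close>)
    have "\<bar>(\<Sum>x\<in>G. f (y x)) - (\<Sum>x\<in>G. f x)\<bar> \<le> (\<Sum>x\<in>G. \<bar>f (y x) - f x\<bar>)"
      by (simp add: sum_subtractf[symmetric])
    also have "\<dots> \<le> (\<Sum>x\<in>G. \<delta>)"
      using y V(3) by (intro sum_mono less_imp_le) auto
    also have "\<dots> < \<epsilon>" using \<delta>(2) by simp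
    finally show ?thesis
      using \<epsilon>(2) by (auto simp: 1 2 dist_real_def abs_minus_commute)
  qed
  then show "\<exists>T. openin (topology_generated_by E) T \<and> \<omega> \<in> T \<and>
      T \<subseteq> {\<omega> \<in> configurations. (\<integral>x. f x \<partial>config_measure \<omega>) \<in> U}"
    using T_open \<omega>T by (intro exI[of _ T]) (auto simp: T_def)
qed

lemma space_config_borel [simp]: "space config_borel = configurations"
  by (simp add: config_borel_def borel_of_def space_measure_of_conv topspace_vague_topology)

lemma sets_config_borel:
  "sets config_borel = sigma_sets configurations
    {U. openin (vague_topology configurations config_measure) U}"
  using openin_subset[of "vague_topology configurations config_measure"]
  by (auto simp: config_borel_def borel_of_def topspace_vague_topology intro!: sets_measure_of)

lemma integral_config_measurable:
  assumes "f \<in> compactly_supported"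
  shows "(\<lambda>\<omega>. \<integral>x. f x \<partial>config_measure \<omega>) \<in> borel_measurable config_borel"
proof (rule borel_measurableI)
  fix S :: "real set" assume S: "open S"
  have "openin (vague_topology configurations config_measure)
      {\<omega> \<in> configurations. (\<integral>x. f x \<partial>config_measure \<omega>) \<in> S}"
    unfolding vague_topology_def using assms S by (intro topology_generated_by_Basis) blast
  then show "(\<lambda>\<omega>. \<integral>x. f x \<partial>config_measure \<omega>) -` S \<inter> space config_borel \<in> sets config_borel"
    by (auto simp: sets_config_borel Int_def conj_commute)
qed

lemma config_laplace_measurable:
  assumes "f \<in> compactly_supported"
  shows "config_laplace f \<in> borel_measurable config_borel"
proof -
  have [measurable]: "(\<lambda>\<omega>. \<integral>x. f x \<partial>config_measure \<omega>) \<in> borel_measurable config_borel"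
    by (rule integral_config_measurable[OF assms])
  show ?thesis unfolding config_laplace_def[abs_def] by measurable
qed

text \<open>By the preceding lemma the vague topology is coarser than the topology generated by countably many
  counting conditions, and these are measurable with respect to the Laplace functionals.\<close>

lemma sets_config_borel_eq_laplace_sigma:
  assumes \<sigma>: "sigma_compact (UNIV :: 'a::metric_space set)"
  shows "sets (config_borel :: 'a::metric_space set measure) = sets laplace_sigma"
proof
  let ?gen = "{{\<omega> \<in> configurations. a < config_laplace f \<omega>} | f a. f \<in> nonneg_test_functions}
    :: 'a set set set"
  have gen: "?gen \<subseteq> sets config_borel"
  proof safe
    fix f :: "'a \<Rightarrow> real" and a
    assume "f \<in> nonneg_test_functions"
    then have "config_laplace f \<in> borel_measurable config_borel"
      by (intro config_laplace_measurable) (simp add: nonneg_test_functions_def)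
    then show "{\<omega> \<in> configurations. a < config_laplace f \<omega>} \<in> sets config_borel"
      by (simp add: borel_measurable_iff_greater)
  qed
  have "sets (laplace_sigma :: 'a set measure) = sigma_sets configurations ?gen"
    unfolding laplace_sigma_def by (rule sets_measure_of) auto
  then show "sets (laplace_sigma :: 'a set measure) \<subseteq> sets config_borel"
    using sets.sigma_sets_subset[OF gen] by simp
next
  obtain \<B> :: "'a set set" where \<B>: "countable \<B>" "\<And>V. V \<in> \<B> \<Longrightarrow> open V"
    "\<And>U x. open U \<Longrightarrow> x \<in> U \<Longrightarrow> \<exists>V\<in>\<B>. x \<in> V \<and> V \<subseteq> U"
    using sigma_compact_countable_ball_base[OF \<sigma>] by metis
  define Q where "Q = (\<lambda>(F, k::nat). {\<omega> \<in> configurations.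
    emeasure (config_measure \<omega>) (\<Union>F \<inter> compact_part) = of_nat k} :: 'a set set)"
  define E where "E = Q ` ({F. finite F \<and> F \<subseteq> \<B>} \<times> UNIV)"
  have E_eq: "E = {{\<omega> \<in> configurations. emeasure (config_measure \<omega>) (\<Union>F \<inter> compact_part) = of_nat k} | F k.
      finite F \<and> F \<subseteq> \<B>}"
    unfolding E_def Q_def by (auto simp: image_def)
  have countable: "countable E"
    unfolding E_def using countable_Collect_finite_subset[OF \<B>(1)] by auto
  have E_sets: "E \<subseteq> sets laplace_sigma"
    unfolding E_eq
  proof safe
    fix F :: "'a set set" and k :: nat assume F: "finite F" "F \<subseteq> \<B>"
    have "open (\<Union>F \<inter> compact_part)"
      using F(2) \<B>(2) open_compact_part by (intro open_Int open_Union) auto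
    then have m: "(\<lambda>\<omega>. emeasure (config_measure \<omega>) (\<Union>F \<inter> compact_part)) \<in> borel_measurable laplace_sigma"
      by (intro emeasure_config_measurable_laplace_sigma[OF \<sigma>]) auto
    show "{\<omega> \<in> configurations. emeasure (config_measure \<omega>) (\<Union>F \<inter> compact_part) = of_nat k}
      \<in> sets laplace_sigma"
      using measurable_sets[OF m, of "{of_nat k}"]
      by (simp add: space_laplace_sigma vimage_def Int_def conj_commute)
  qed
  have E_union: "\<Union>E = configurations"
  proof
    show "\<Union>E \<subseteq> configurations" by (auto simp: E_eq)
    have "configurations = Q ({}, 0)" by (simp add: Q_def)
    then show "configurations \<subseteq> \<Union>E" unfolding E_def by blast
  qed
  have "U \<in> sets laplace_sigma" if "openin (vague_topology configurations config_measure) U" for U :: "'a set set"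
  proof -
    have "openin (topology_generated_by E) U"
      unfolding openin_topology_generated_by_iff
    proof (rule generate_topology_on_coarsest[OF istopology_generate_topology_on])
      show "generate_topology_on {{x \<in> configurations. (\<integral>y. f y \<partial>config_measure x) \<in> U} |f U. f \<in> compactly_supported \<and> open U} U"
        using that unfolding vague_topology_def openin_topology_generated_by_iff .
      fix s :: "'a set set"
      assume "s \<in> {{x \<in> configurations. (\<integral>y. f y \<partial>config_measure x) \<in> U} |f U. f \<in> compactly_supported \<and> open U}"
      then obtain f V where s: "s = {x \<in> configurations. (\<integral>y. f y \<partial>config_measure x) \<in> V}"
        and f: "f \<in> compactly_supported" and V: "open V" by auto
      show "generate_topology_on E s"
        unfolding s
        using vague_basic_open_by_counts[OF \<B>(2,3) f V, folded E_eq]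
        by (simp only: openin_topology_generated_by_iff)
    qed
    then have "U \<in> sigma_sets configurations E"
      using generate_topology_on_countable_sigma_sets[OF countable] E_union
      by (simp add: openin_topology_generated_by_iff)
    also have "\<dots> \<subseteq> sets laplace_sigma"
      using sets.sigma_sets_subset[OF E_sets] by (simp add: space_laplace_sigma)
    finally show ?thesis .
  qed
  then have "{U. openin (vague_topology configurations config_measure) U} \<subseteq> sets (laplace_sigma :: 'a set measure)"
    by blast
  then show "sets config_borel \<subseteq> sets (laplace_sigma :: 'a set measure)"
    unfolding sets_config_borel using sets.sigma_sets_subset space_laplace_sigma by metis
qed

lemma emeasure_config_measurable:
  fixes A :: "'a::metric_space set"
  assumes \<sigma>: "sigma_compact (UNIV :: 'a set)" and A: "open A" "A \<subseteq> compact_part"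
  shows "(\<lambda>\<omega>. emeasure (config_measure \<omega>) A) \<in> borel_measurable config_borel"
  using emeasure_config_measurable_laplace_sigma[OF assms]
  by (simp cong: measurable_cong_sets add: sets_config_borel_eq_laplace_sigma[OF \<sigma>])

section \<open>Adding a random point to a configuration\<close>

text \<open>Since configurations are closed, \<open>x\<close> belongs to \<open>\<omega>\<close> as soon as every basic neighbourhood of \<open>x\<close>
  contains a point of \<open>\<omega>\<close>; this makes membership a countable combination of counting conditions.\<close>

lemma point_in_config_sets:
  assumes \<sigma>: "sigma_compact (UNIV :: 'a::metric_space set)"
  shows "{(x, \<omega>). x \<in> compact_part \<and> x \<in> \<omega> \<and> \<omega> \<in> configurations}
    \<in> sets (borel \<Otimes>\<^sub>M (config_borel :: 'a::metric_space set measure))" (is "?D \<in> sets ?M")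
proof -
  obtain \<B> :: "'a set set" where \<B>: "countable \<B>" "\<And>V. V \<in> \<B> \<Longrightarrow> open V"
    "\<And>U x. open U \<Longrightarrow> x \<in> U \<Longrightarrow> \<exists>V\<in>\<B>. x \<in> V \<and> V \<subseteq> U"
    using sigma_compact_countable_ball_base[OF \<sigma>] by metis
  define S where "S V = (- V) \<times> configurations \<union>
    UNIV \<times> {\<omega> \<in> configurations. 1 \<le> emeasure (config_measure \<omega>) (V \<inter> compact_part)}" for V :: "'a set"
  have S_sets: "S V \<in> sets ?M" if V: "V \<in> \<B>" for V
  proof -
    have "(\<lambda>\<omega>. emeasure (config_measure \<omega>) (V \<inter> compact_part)) \<in> borel_measurable config_borel"
      using \<B>(2)[OF V] open_compact_part by (intro emeasure_config_measurable[OF \<sigma>]) auto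
    then have "{\<omega> \<in> space config_borel. 1 \<le> emeasure (config_measure \<omega>) (V \<inter> compact_part)} \<in> sets config_borel"
      by measurable
    moreover have "configurations \<in> sets (config_borel :: 'a set measure)"
      using sets.top[of config_borel] by simp
    moreover have "- V \<in> sets borel" "UNIV \<in> sets (borel :: 'a measure)"
      using \<B>(2)[OF V] by auto
    ultimately show ?thesis unfolding S_def by (intro sets.Un pair_measureI) auto
  qed
  have meas: "V \<inter> compact_part \<in> sets borel" if "V \<in> \<B>" for V
    using \<B>(2)[OF that] open_compact_part by (intro borel_open open_Int)
  have "?D = (\<Inter>V\<in>\<B>. S V) \<inter> (compact_part \<times> configurations)"
  proof (intro equalityI subsetI)
    fix p assume "p \<in> ?D"
    then show "p \<in> (\<Inter>V\<in>\<B>. S V) \<inter> (compact_part \<times> configurations)"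
      using emeasure_config_ge_1[OF meas] by (auto simp: S_def)
  next
    fix p assume p: "p \<in> (\<Inter>V\<in>\<B>. S V) \<inter> (compact_part \<times> configurations)"
    obtain x \<omega> where x\<omega>: "p = (x, \<omega>)" by (cases p)
    have \<omega>: "\<omega> \<in> configurations" and x: "x \<in> compact_part" using p x\<omega> by auto
    obtain e where e: "0 < e" "\<omega> \<inter> ball x e \<subseteq> {x}"
      using configuration_isolating_ball[OF \<omega>] by blast
    obtain V where V: "V \<in> \<B>" "x \<in> V" "V \<subseteq> ball x e"
      using \<B>(3)[of "ball x e" x] e by auto
    have "\<omega> \<inter> (V \<inter> compact_part) \<noteq> {}"
      using p V(1,2) emeasure_config_ge_1[OF meas[OF V(1)], of \<omega>] by (auto simp: S_def x\<omega>)
    then show "p \<in> ?D" using V e \<omega> x by (auto simp: x\<omega>)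
  qed
  moreover have "\<B> \<noteq> {}" using \<B>(3)[of UNIV undefined] by auto
  moreover have "compact_part \<times> configurations \<in> sets ?M"
    using borel_open[OF open_compact_part] sets.top[of "config_borel :: 'a set measure"]
    by (intro pair_measureI) auto
  ultimately show ?thesis
    using S_sets \<B>(1) by (simp only:) (intro sets.Int sets.countable_INT', auto)
qed

text \<open>If \<open>x \<notin> compact_part\<close> then \<open>f x = 0\<close>, and both alternatives give the factor 1. Only membership of
  points of \<open>compact_part\<close>, which is a measurable event, therefore enters the formula.\<close>

lemma config_laplace_insert:
  fixes f :: "'a::metric_space \<Rightarrow> real"
  assumes \<omega>: "\<omega> \<in> configurations" and f: "f \<in> compactly_supported"
  shows "config_laplace f (insert x \<omega>)
    = config_laplace f \<omega> * (if x \<in> compact_part \<and> x \<in> \<omega> then 1 else exp (- f x))"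
proof (cases "x \<in> \<omega>")
  case True
  then have "x \<in> compact_part \<or> f x = 0"
    using compactly_supported_imp_compact_part[OF f] by blast
  then show ?thesis using True by (auto simp: insert_absorb)
next
  case False
  then show ?thesis
    using integral_config_insert[OF \<omega> f] by (simp add: config_laplace_def exp_add[symmetric])
qed

lemma insert_config_measurable:
  assumes \<sigma>: "sigma_compact (UNIV :: 'a::metric_space set)"
  shows "(\<lambda>(x, \<omega>). insert x \<omega>) \<in> borel \<Otimes>\<^sub>M (config_borel :: 'a::metric_space set measure) \<rightarrow>\<^sub>M config_borel"
proof -
  let ?M = "borel \<Otimes>\<^sub>M (config_borel :: 'a set measure)"
  have "(\<lambda>(x, \<omega>). insert x \<omega>) \<in> ?M \<rightarrow>\<^sub>M laplace_sigma"
    unfolding laplace_sigma_def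
  proof (rule measurable_measure_of)
    show "(\<lambda>(x, \<omega>). insert x \<omega>) \<in> space ?M \<rightarrow> configurations"
      by (auto simp: space_pair_measure configurations_insert)
    fix A :: "'a set set"
    assume "A \<in> {{\<omega> \<in> configurations. a < config_laplace f \<omega>} | f a. f \<in> nonneg_test_functions}"
    then obtain f a where A: "A = {\<omega> \<in> configurations. a < config_laplace f \<omega>}"
      and f: "f \<in> compactly_supported" by (auto simp: nonneg_test_functions_def)
    let ?D = "{(x, \<omega>). x \<in> compact_part \<and> x \<in> \<omega> \<and> \<omega> \<in> configurations} :: ('a \<times> 'a set) set"
    have [measurable]: "?D \<in> sets ?M" by (rule point_in_config_sets[OF \<sigma>])
    have [measurable]: "f \<in> borel_measurable borel" "config_laplace f \<in> borel_measurable config_borel"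
      using compactly_supported_borel[OF f] config_laplace_measurable[OF f] by auto
    have "(\<lambda>p. config_laplace f (snd p) * (if p \<in> ?D then 1 else exp (- f (fst p)))) \<in> borel_measurable ?M"
      by measurable
    then have "{p \<in> space ?M. a < config_laplace f (snd p) * (if p \<in> ?D then 1 else exp (- f (fst p)))} \<in> sets ?M"
      by measurable
    also have "{p \<in> space ?M. a < config_laplace f (snd p) * (if p \<in> ?D then 1 else exp (- f (fst p)))}
      = (\<lambda>(x, \<omega>). insert x \<omega>) -` A \<inter> space ?M"
      by (auto simp: A space_pair_measure configurations_insert config_laplace_insert[OF _ f] split: if_splits)
    finally show "(\<lambda>(x, \<omega>). insert x \<omega>) -` A \<inter> space ?M \<in> sets ?M" .
  qed auto
  then show ?thesis
    by (simp cong: measurable_cong_sets add: sets_config_borel_eq_laplace_sigma[OF \<sigma>])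
qed

text \<open>A point added at \<open>x\<close> multiplies the Laplace functional by \<open>exp (- f x)\<close> only if it is not already
  present. Under this property it is almost surely new, wherever this can be observed.\<close>

definition no_fixed_points :: "'a::metric_space set measure \<Rightarrow> bool" where
  "no_fixed_points P \<longleftrightarrow> prob_space P \<and> sets P = sets config_borel \<and>
     (\<forall>x\<in>compact_part. AE \<omega> in P. x \<notin> \<omega>)"

lemma no_fixed_points_space: "no_fixed_points P \<Longrightarrow> space P = configurations"
  by (metis no_fixed_points_def sets_eq_imp_space_eq space_config_borel)

lemma no_fixed_pointsD:
  assumes "no_fixed_points P"
  shows "prob_space P" "sets P = sets config_borel" "\<And>x. x \<in> compact_part \<Longrightarrow> AE \<omega> in P. x \<notin> \<omega>"
  using assms by (auto simp: no_fixed_points_def)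

lemma integrable_bounded_config:
  fixes G :: "'a::metric_space set \<Rightarrow> real"
  assumes P: "prob_space P" "sets P = sets config_borel"
    and G: "G \<in> borel_measurable config_borel" "\<And>\<omega>. \<omega> \<in> configurations \<Longrightarrow> \<bar>G \<omega>\<bar> \<le> C"
  shows "integrable P G"
proof -
  interpret P: prob_space P by fact
  have "space P = configurations" using P(2) by (metis sets_eq_imp_space_eq space_config_borel)
  then show ?thesis
    using P(2) G by (intro P.integrable_const_bound[of _ C]) (auto cong: measurable_cong_sets)
qed

lemma config_laplace_bounds:
  assumes "f \<in> nonneg_test_functions"
  shows "config_laplace f \<omega> \<in> {0..1}"
  using assms by (auto simp: config_laplace_def nonneg_test_functions_def)

lemma nonneg_test_functionsD:
  assumes "f \<in> nonneg_test_functions"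
  shows "f \<in> compactly_supported" "0 \<le> f x"
  using assms by (auto simp: nonneg_test_functions_def)

text \<open>The common law \<open>B\<close> of the points that are added. Being diffuse, it keeps them distinct.\<close>

locale diffuse_prob = prob_space B for B :: "'a::metric_space measure" +
  assumes sigma_compact: "sigma_compact (UNIV :: 'a set)"
    and sets_B: "sets B = sets borel"
    and diffuse: "emeasure B {x} = 0"
begin

definition add_point :: "'a set measure \<Rightarrow> 'a set measure" where
  "add_point P = distr (B \<Otimes>\<^sub>M P) config_borel (\<lambda>(x, \<omega>). insert x \<omega>)"

lemma insert_measurable:
  assumes "sets P = sets config_borel"
  shows "(\<lambda>(x, \<omega>). insert x \<omega>) \<in> B \<Otimes>\<^sub>M P \<rightarrow>\<^sub>M config_borel"
  using insert_config_measurable[OF sigma_compact]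
  by (simp cong: measurable_cong_sets add: sets_pair_measure_cong[OF sets_B assms])

lemma integral_add_point:
  fixes G :: "'a set \<Rightarrow> real"
  assumes P: "prob_space P" "sets P = sets config_borel"
    and G: "G \<in> borel_measurable config_borel" "\<And>\<omega>. \<omega> \<in> configurations \<Longrightarrow> \<bar>G \<omega>\<bar> \<le> C"
  shows "integrable B (\<lambda>x. \<integral>\<omega>. G (insert x \<omega>) \<partial>P)"
    and "(\<integral>\<omega>. G \<omega> \<partial>add_point P) = (\<integral>x. (\<integral>\<omega>. G (insert x \<omega>) \<partial>P) \<partial>B)"
proof -
  interpret P: prob_space P by fact
  interpret BP: pair_prob_space B P ..
  have [measurable]: "(\<lambda>p. insert (fst p) (snd p)) \<in> B \<Otimes>\<^sub>M P \<rightarrow>\<^sub>M config_borel"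
    using insert_measurable[OF P(2)] by (simp add: case_prod_unfold)
  have [measurable]: "G \<in> borel_measurable config_borel" by fact
  have space: "space P = configurations" using P(2) by (metis sets_eq_imp_space_eq space_config_borel)
  have int: "integrable (B \<Otimes>\<^sub>M P) (\<lambda>p. G (insert (fst p) (snd p)))"
    using G(2)[OF configurations_insert] space
    by (intro BP.integrable_const_bound[of _ C]) (auto simp: space_pair_measure intro!: AE_I2)
  show "integrable B (\<lambda>x. \<integral>\<omega>. G (insert x \<omega>) \<partial>P)"
    using BP.integrable_fst'[OF int] by simp
  have "(\<integral>\<omega>. G \<omega> \<partial>add_point P) = (\<integral>p. G (insert (fst p) (snd p)) \<partial>(B \<Otimes>\<^sub>M P))"
    unfolding add_point_def case_prod_unfold by (rule integral_distr) measurable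
  also have "\<dots> = (\<integral>x. (\<integral>\<omega>. G (insert x \<omega>) \<partial>P) \<partial>B)"
    using BP.integral_fst'[OF int] by simp
  finally show "(\<integral>\<omega>. G \<omega> \<partial>add_point P) = (\<integral>x. (\<integral>\<omega>. G (insert x \<omega>) \<partial>P) \<partial>B)" .
qed

lemma not_in_config_sets:
  fixes x :: 'a
  assumes "x \<in> compact_part"
  shows "{\<omega> \<in> configurations. x \<notin> \<omega>} \<in> sets config_borel"
proof -
  have "Pair x -` {(x, \<omega>). x \<in> compact_part \<and> x \<in> \<omega> \<and> \<omega> \<in> configurations} \<in> sets config_borel"
    by (rule sets_Pair1[OF point_in_config_sets[OF sigma_compact]])
  then have "space config_borel - {\<omega> \<in> configurations. x \<in> \<omega>} \<in> sets config_borel"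
    using assms by (intro sets.compl_sets) (simp add: vimage_def conj_commute)
  also have "space config_borel - {\<omega> \<in> configurations. x \<in> \<omega>} = {\<omega> \<in> configurations. x \<notin> \<omega>}"
    by auto
  finally show ?thesis .
qed

lemma no_fixed_points_add_point:
  assumes P: "no_fixed_points P"
  shows "no_fixed_points (add_point P)"
proof -
  interpret P: prob_space P by (rule no_fixed_pointsD[OF P])
  interpret BP: pair_prob_space B P ..
  note ins = insert_measurable[OF no_fixed_pointsD(2)[OF P]]
  have "AE \<omega> in add_point P. x \<notin> \<omega>" if x: "x \<in> compact_part" for x
  proof -
    have sets: "{\<omega> \<in> space config_borel. x \<notin> \<omega>} \<in> sets config_borel"
      using not_in_config_sets[OF x] by simp
    have "AE p in B \<Otimes>\<^sub>M P. x \<notin> (\<lambda>(x, \<omega>). insert x \<omega>) p"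
    proof (rule BP.AE_pair_measure)
      have "(\<lambda>(x, \<omega>). insert x \<omega>) -` {\<omega> \<in> space config_borel. x \<notin> \<omega>} \<inter> space (B \<Otimes>\<^sub>M P)
        \<in> sets (B \<Otimes>\<^sub>M P)"
        by (rule measurable_sets[OF ins sets])
      also have "(\<lambda>(x, \<omega>). insert x \<omega>) -` {\<omega> \<in> space config_borel. x \<notin> \<omega>} \<inter> space (B \<Otimes>\<^sub>M P)
        = {p \<in> space (B \<Otimes>\<^sub>M P). x \<notin> (\<lambda>(x, \<omega>). insert x \<omega>) p}"
        using measurable_space[OF ins] by auto
      finally show "{p \<in> space (B \<Otimes>\<^sub>M P). x \<notin> (\<lambda>(x, \<omega>). insert x \<omega>) p} \<in> sets (B \<Otimes>\<^sub>M P)" .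
      have "AE y in B. y \<noteq> x"
        by (rule AE_I[of _ _ "{x}"]) (auto simp: diffuse sets_B)
      then show "AE y in B. AE \<omega> in P. x \<notin> (\<lambda>(x, \<omega>). insert x \<omega>) (y, \<omega>)"
        using no_fixed_pointsD(3)[OF P x] by (auto elim!: eventually_mono)
    qed
    then show ?thesis
      unfolding add_point_def using AE_distr_iff[OF ins sets] by simp
  qed
  moreover have "prob_space (add_point P)"
    unfolding add_point_def by (rule BP.prob_space_distr[OF ins])
  moreover have "sets (add_point P) = sets config_borel" by (simp add: add_point_def)
  ultimately show ?thesis unfolding no_fixed_points_def by blast
qed

text \<open>For each \<open>x\<close>, almost surely either \<open>x \<notin> \<omega>\<close> or \<open>f x = 0\<close>, so inserting \<open>x\<close> multiplies
  \<open>config_laplace f \<omega>\<close> by \<open>exp (- f x)\<close>.\<close>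

lemma integral_laplace_add_point:
  assumes P: "no_fixed_points P" and f: "f \<in> nonneg_test_functions"
  shows "(\<integral>\<omega>. config_laplace f \<omega> \<partial>add_point P)
    = (\<integral>x. exp (- f x) \<partial>B) * (\<integral>\<omega>. config_laplace f \<omega> \<partial>P)"
proof -
  note f' = nonneg_test_functionsD(1)[OF f]
  have m: "config_laplace f \<in> borel_measurable config_borel"
    by (rule config_laplace_measurable[OF f'])
  have mP: "config_laplace f \<in> borel_measurable P"
    using m no_fixed_pointsD(2)[OF P] by (simp cong: measurable_cong_sets)
  have "(\<integral>\<omega>. config_laplace f (insert x \<omega>) \<partial>P) = exp (- f x) * (\<integral>\<omega>. config_laplace f \<omega> \<partial>P)" for x
  proof -
    have eq: "config_laplace f (insert x \<omega>) = exp (- f x) * config_laplace f \<omega>"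
      if "x \<in> compact_part \<longrightarrow> x \<notin> \<omega>" "\<omega> \<in> space P" for \<omega>
      using that config_laplace_insert[OF _ f'] no_fixed_points_space[OF P] by auto
    have "AE \<omega> in P. x \<in> compact_part \<longrightarrow> x \<notin> \<omega>"
      using no_fixed_pointsD(3)[OF P] by (cases "x \<in> compact_part") auto
    then have ae: "AE \<omega> in P. config_laplace f (insert x \<omega>) = exp (- f x) * config_laplace f \<omega>"
      using AE_space by eventually_elim (rule eq)
    have "x \<in> space B" using sets_eq_imp_space_eq[OF sets_B] by simp
    then have "(\<lambda>\<omega>. insert x \<omega>) \<in> P \<rightarrow>\<^sub>M config_borel"
      using measurable_compose[OF measurable_Pair1' insert_measurable[OF no_fixed_pointsD(2)[OF P]]]
      by simp
    then have "(\<lambda>\<omega>. config_laplace f (insert x \<omega>)) \<in> borel_measurable P"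
      using m by (rule measurable_compose)
    then have "(\<integral>\<omega>. config_laplace f (insert x \<omega>) \<partial>P) = (\<integral>\<omega>. exp (- f x) * config_laplace f \<omega> \<partial>P)"
      using ae mP by (intro integral_cong_AE) auto
    then show ?thesis by simp
  qed
  then show ?thesis
    using integral_add_point(2)[OF no_fixed_pointsD(1,2)[OF P] m, of 1] config_laplace_bounds[OF f]
    by simp
qed

end

lemma config_measure_singleton:
  fixes \<omega> :: "'a::metric_space set"
  shows "measure (config_measure \<omega>) {x} = indicator \<omega> x"
proof -
  have "emeasure (config_measure \<omega>) {x} = of_nat (if x \<in> \<omega> then 1 else 0)"
    by (subst emeasure_config_eq_of_nat) auto
  then show ?thesis by (auto simp: measure_def)
qed

lemma rho1_insert_le: "rho1 (insert x \<omega>) \<omega> \<le> 1"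
proof -
  have "rho1 (insert x \<omega>) \<omega> = (\<Sum>\<^sub>\<infinity>y\<in>{x}. ennreal \<bar>indicator (insert x \<omega>) y - indicator \<omega> y\<bar>)"
    unfolding rho1_def config_measure_singleton
    by (rule infsum_cong_neutral) (auto simp: indicator_def)
  also have "\<dots> \<le> 1" by (simp add: indicator_def)
  finally show ?thesis .
qed

lemma rho1_Lip1_insert:
  assumes "F \<in> rho1_Lip1" "\<omega> \<in> configurations"
  shows "\<bar>F (insert x \<omega>) - F \<omega>\<bar> \<le> 1"
proof -
  have "ennreal \<bar>F (insert x \<omega>) - F \<omega>\<bar> \<le> rho1 (insert x \<omega>) \<omega>"
    using assms configurations_insert[OF assms(2)] unfolding rho1_Lip1_def by blast
  also have "\<dots> \<le> 1" by (rule rho1_insert_le)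
  finally show ?thesis by simp
qed

lemma rho1_Lip1_bounded:
  assumes "F \<in> rho1_Lip1"
  obtains C where "\<And>\<omega>. \<omega> \<in> configurations \<Longrightarrow> \<bar>F \<omega>\<bar> \<le> C"
  using assms unfolding rho1_Lip1_def bounded_real by blast

lemma rho1_Lip1_measurable: "F \<in> rho1_Lip1 \<Longrightarrow> F \<in> borel_measurable config_borel"
  by (simp add: rho1_Lip1_def)

context diffuse_prob
begin

lemma add_point_Lip1:
  assumes P: "no_fixed_points P" and F: "F \<in> rho1_Lip1"
  shows "\<bar>(\<integral>\<omega>. F \<omega> \<partial>add_point P) - (\<integral>\<omega>. F \<omega> \<partial>P)\<bar> \<le> 1"
proof -
  interpret P: prob_space P by (rule no_fixed_pointsD[OF P])
  obtain C where C: "\<And>\<omega>. \<omega> \<in> configurations \<Longrightarrow> \<bar>F \<omega>\<bar> \<le> C"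
    using rho1_Lip1_bounded[OF F] by blast
  note m = rho1_Lip1_measurable[OF F]
  note add = integral_add_point[OF no_fixed_pointsD(1,2)[OF P] m C]
  have mP: "integrable P F"
    by (rule integrable_bounded_config[OF no_fixed_pointsD(1,2)[OF P] m C])
  have bound: "\<bar>(\<integral>\<omega>. F (insert x \<omega>) \<partial>P) - (\<integral>\<omega>. F \<omega> \<partial>P)\<bar> \<le> 1" for x
  proof -
    have "x \<in> space B" using sets_eq_imp_space_eq[OF sets_B] by simp
    then have "(\<lambda>\<omega>. insert x \<omega>) \<in> P \<rightarrow>\<^sub>M config_borel"
      using measurable_compose[OF measurable_Pair1' insert_measurable[OF no_fixed_pointsD(2)[OF P]]]
      by simp
    then have "(\<lambda>\<omega>. F (insert x \<omega>)) \<in> borel_measurable P"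
      using m by (rule measurable_compose)
    then have i: "integrable P (\<lambda>\<omega>. F (insert x \<omega>))"
      using C configurations_insert no_fixed_points_space[OF P]
      by (intro P.integrable_const_bound[of _ C]) (auto intro!: AE_I2)
    have "\<bar>\<integral>\<omega>. F (insert x \<omega>) - F \<omega> \<partial>P\<bar> \<le> (\<integral>\<omega>. \<bar>F (insert x \<omega>) - F \<omega>\<bar> \<partial>P)"
      by (rule integral_abs_bound)
    also have "\<dots> \<le> 1"
      using i mP rho1_Lip1_insert[OF F] no_fixed_points_space[OF P]
      by (intro P.integral_le_const) auto
    finally show ?thesis using i mP by simp
  qed
  have "(\<integral>\<omega>. F \<omega> \<partial>add_point P) - (\<integral>\<omega>. F \<omega> \<partial>P) = (\<integral>x. (\<integral>\<omega>. F (insert x \<omega>) \<partial>P) - (\<integral>\<omega>. F \<omega> \<partial>P) \<partial>B)"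
    using add by (simp add: prob_space)
  also have "\<bar>\<dots>\<bar> \<le> (\<integral>x. \<bar>(\<integral>\<omega>. F (insert x \<omega>) \<partial>P) - (\<integral>\<omega>. F \<omega> \<partial>P)\<bar> \<partial>B)"
    by (rule integral_abs_bound)
  also have "\<dots> \<le> 1" using add(1) bound by (intro integral_le_const) auto
  finally show ?thesis .
qed

lemma no_fixed_points_funpow: "no_fixed_points P \<Longrightarrow> no_fixed_points ((add_point ^^ n) P)"
  by (induction n) (auto intro: no_fixed_points_add_point)

lemma integral_laplace_funpow:
  assumes P: "no_fixed_points P" and f: "f \<in> nonneg_test_functions"
  shows "(\<integral>\<omega>. config_laplace f \<omega> \<partial>(add_point ^^ n) P)
    = (\<integral>x. exp (- f x) \<partial>B) ^ n * (\<integral>\<omega>. config_laplace f \<omega> \<partial>P)"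
  by (induction n) (simp_all add: integral_laplace_add_point[OF no_fixed_points_funpow[OF P] f])

lemma add_points_Lip1:
  assumes P: "no_fixed_points P" and F: "F \<in> rho1_Lip1"
  shows "\<bar>(\<integral>\<omega>. F \<omega> \<partial>(add_point ^^ n) P) - (\<integral>\<omega>. F \<omega> \<partial>P)\<bar> \<le> real n"
proof (induction n)
  case (Suc n)
  then show ?case using add_point_Lip1[OF no_fixed_points_funpow[OF P, of n] F] by simp
qed simp

end

section \<open>Moments of the Poisson distribution\<close>

lemma integral_measure_pmf_nat_sums:
  fixes g :: "nat \<Rightarrow> real"
  assumes g: "\<And>n. 0 \<le> g n" and s: "(\<lambda>n. pmf p n * g n) sums s"
  shows "integrable (measure_pmf p) g" "(\<integral>n. g n \<partial>measure_pmf p) = s"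
proof -
  have i: "integrable (count_space UNIV) (\<lambda>n. pmf p n * g n)"
    using s g by (simp add: integrable_count_space_nat_iff sums_iff)
  show "integrable (measure_pmf p) g"
    unfolding measure_pmf_eq_density using i by (subst integrable_density) auto
  have "(\<integral>n. g n \<partial>measure_pmf p) = (\<integral>n. pmf p n * g n \<partial>count_space UNIV)"
    unfolding measure_pmf_eq_density by (subst integral_density) auto
  also have "\<dots> = s" using sums_unique2[OF sums_integral_count_space_nat[OF i] s] .
  finally show "(\<integral>n. g n \<partial>measure_pmf p) = s" .
qed

lemma poisson_pmf_generating_function:
  assumes "0 < r" "0 \<le> c"
  shows "(\<integral>n. c ^ n \<partial>poisson_pmf r) = exp (r * (c - 1))"
proof (rule integral_measure_pmf_nat_sums)
  have "(\<lambda>n. exp (- r) * ((r * c) ^ n /\<^sub>R fact n)) sums (exp (- r) * exp (r * c))"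
    by (intro sums_mult exp_converges)
  then show "(\<lambda>n. pmf (poisson_pmf r) n * c ^ n) sums exp (r * (c - 1))"
    using assms by (simp add: exp_add[symmetric] algebra_simps power_mult_distrib divide_inverse)
qed (use assms in simp)

lemma poisson_pmf_mean:
  assumes "0 < r"
  shows "integrable (poisson_pmf r) real" "(\<integral>n. real n \<partial>poisson_pmf r) = r"
proof -
  have "(\<lambda>n. r * exp (- r) * (r ^ n /\<^sub>R fact n)) sums (r * exp (- r) * exp r)"
    by (intro sums_mult exp_converges)
  then have "(\<lambda>n. pmf (poisson_pmf r) (Suc n) * real (Suc n)) sums r"
    using assms by (simp add: exp_minus field_simps del: of_nat_Suc)
  then have s: "(\<lambda>n. pmf (poisson_pmf r) n * real n) sums r"
    by (subst (asm) sums_Suc_iff) simp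
  show "integrable (poisson_pmf r) real" "(\<integral>n. real n \<partial>poisson_pmf r) = r"
    using integral_measure_pmf_nat_sums[OF _ s] by auto
qed

section \<open>Laws determined by their Laplace functionals\<close>

lemma config_laplace_mult:
  fixes f g :: "'a::metric_space \<Rightarrow> real"
  assumes \<omega>: "\<omega> \<in> configurations" and f: "f \<in> compactly_supported" and g: "g \<in> compactly_supported"
  shows "config_laplace (\<lambda>x. f x + g x) \<omega> = config_laplace f \<omega> * config_laplace g \<omega>"
  using integrable_config_measure[OF \<omega> f] integrable_config_measure[OF \<omega> g]
  by (simp add: config_laplace_def exp_add[symmetric])

text \<open>The monotone class theorem for the Laplace variables. They are multiplicative only on
  configurations, so \<open>H\<close> consists of all functions that agree there with a Laplace variable.\<close>

lemma config_monotone_class: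
  fixes V :: "('a::metric_space set \<Rightarrow> real) \<Rightarrow> bool"
  assumes \<sigma>: "sigma_compact (UNIV :: 'a set)"
    and V_laplace: "\<And>f. f \<in> nonneg_test_functions \<Longrightarrow> V (config_laplace f)"
    and V_add: "\<And>Y Z. V Y \<Longrightarrow> V Z \<Longrightarrow> V (\<lambda>w. Y w + Z w)"
    and V_scale: "\<And>c Z. V Z \<Longrightarrow> V (\<lambda>w. c * Z w)"
    and V_lim: "\<And>Z Z' B. (\<And>n. V (Z n)) \<Longrightarrow> (\<And>n w. w \<in> configurations \<Longrightarrow> \<bar>Z n w\<bar> \<le> B) \<Longrightarrow>
      (\<And>w. w \<in> configurations \<Longrightarrow> (\<lambda>n::nat. Z n w) \<longlonglongrightarrow> Z' w) \<Longrightarrow> V Z'"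
    and F: "F \<in> borel_measurable config_borel" "\<And>w. w \<in> configurations \<Longrightarrow> \<bar>F w\<bar> \<le> C"
  shows "V F"
proof (rule functional_monotone_class[where M = config_borel and V = V and F = F and B = C
      and H = "{X. \<exists>f\<in>nonneg_test_functions. \<forall>\<omega>\<in>configurations. X \<omega> = config_laplace f \<omega>}"])
  show "sets (config_borel :: 'a set measure) = sigma_sets (space config_borel) {{\<omega> \<in> space config_borel. a < X \<omega>} | X a.
      X \<in> {X. \<exists>f\<in>nonneg_test_functions. \<forall>\<omega>\<in>configurations. X \<omega> = config_laplace f \<omega>}}"
  proof -
    have "sets (config_borel :: 'a set measure) = sigma_sets configurations
      {{\<omega> \<in> configurations. a < config_laplace f \<omega>} | f a. f \<in> nonneg_test_functions}"
      unfolding sets_config_borel_eq_laplace_sigma[OF \<sigma>] laplace_sigma_def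
      by (rule sets_measure_of) auto
    also have "({{\<omega> \<in> configurations. a < config_laplace f \<omega>} | f a. f \<in> nonneg_test_functions} :: 'a set set set)
      = {{\<omega> \<in> configurations. a < X \<omega>} | X a.
      X \<in> {X. \<exists>f\<in>nonneg_test_functions. \<forall>\<omega>\<in>configurations. X \<omega> = config_laplace f \<omega>}}"
    proof (intro equalityI subsetI)
      fix A :: "'a set set"
      assume "A \<in> {{\<omega> \<in> configurations. a < config_laplace f \<omega>} | f a. f \<in> nonneg_test_functions}"
      then show "A \<in> {{\<omega> \<in> configurations. a < X \<omega>} | X a.
        X \<in> {X. \<exists>f\<in>nonneg_test_functions. \<forall>\<omega>\<in>configurations. X \<omega> = config_laplace f \<omega>}}"
        by blast
    next
      fix A :: "'a set set"
      assume "A \<in> {{\<omega> \<in> configurations. a < X \<omega>} | X a.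
        X \<in> {X. \<exists>f\<in>nonneg_test_functions. \<forall>\<omega>\<in>configurations. X \<omega> = config_laplace f \<omega>}}"
      then obtain X a f where A: "A = {\<omega> \<in> configurations. a < X \<omega>}" and f: "f \<in> nonneg_test_functions"
        and X: "\<And>\<omega>. \<omega> \<in> configurations \<Longrightarrow> X \<omega> = config_laplace f \<omega>" by auto
      have "A = {\<omega> \<in> configurations. a < config_laplace f \<omega>}" using X by (auto simp: A)
      then show "A \<in> {{\<omega> \<in> configurations. a < config_laplace f \<omega>} | f a. f \<in> nonneg_test_functions}"
        using f by blast
    qed
    finally show ?thesis by simp
  qed
next
  fix X Y :: "'a set \<Rightarrow> real"
  assume "X \<in> {X. \<exists>f\<in>nonneg_test_functions. \<forall>\<omega>\<in>configurations. X \<omega> = config_laplace f \<omega>}"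
    "Y \<in> {X. \<exists>f\<in>nonneg_test_functions. \<forall>\<omega>\<in>configurations. X \<omega> = config_laplace f \<omega>}"
  then obtain f g where f: "f \<in> nonneg_test_functions" "\<And>\<omega>. \<omega> \<in> configurations \<Longrightarrow> X \<omega> = config_laplace f \<omega>"
    and g: "g \<in> nonneg_test_functions" "\<And>\<omega>. \<omega> \<in> configurations \<Longrightarrow> Y \<omega> = config_laplace g \<omega>"
    by auto
  have "(\<lambda>x. f x + g x) \<in> nonneg_test_functions"
    using f(1) g(1) by (auto simp: nonneg_test_functions_def intro: compactly_supported_add)
  then show "(\<lambda>w. X w * Y w) \<in> {X. \<exists>f\<in>nonneg_test_functions. \<forall>\<omega>\<in>configurations. X \<omega> = config_laplace f \<omega>}"
    using f g by (auto intro!: bexI[of _ "\<lambda>x. f x + g x"] simp: config_laplace_mult nonneg_test_functionsD)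
next
  have "(\<lambda>_. 0) \<in> (nonneg_test_functions :: ('a \<Rightarrow> real) set)"
    by (simp add: nonneg_test_functions_def compactly_supported_zero)
  then show "(\<lambda>_. 1) \<in> {X. \<exists>f\<in>nonneg_test_functions. \<forall>\<omega>\<in>configurations. X \<omega> = config_laplace (f :: 'a \<Rightarrow> real) \<omega>}"
    by (intro CollectI bexI[of _ "\<lambda>_. 0"]) (auto simp: config_laplace_def)
next
  fix X :: "'a set \<Rightarrow> real"
  assume "X \<in> {X. \<exists>f\<in>nonneg_test_functions. \<forall>\<omega>\<in>configurations. X \<omega> = config_laplace f \<omega>}"
  then obtain f where f: "f \<in> nonneg_test_functions" "\<And>\<omega>. \<omega> \<in> configurations \<Longrightarrow> X \<omega> = config_laplace f \<omega>"
    by auto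
  show "V X"
    by (rule V_lim[of "\<lambda>_. config_laplace f" 1])
      (use V_laplace f config_laplace_bounds[OF f(1)] in auto)
  show "X w \<in> {0..1}" if "w \<in> space config_borel" for w
    using that f(2) config_laplace_bounds[OF f(1)] by simp
next
  fix Z Z' B
  assume "\<And>n. V (Z n)" "\<And>n w. w \<in> space config_borel \<Longrightarrow> \<bar>Z n w\<bar> \<le> B"
    "\<And>w. w \<in> space config_borel \<Longrightarrow> (\<lambda>n::nat. Z n w) \<longlonglongrightarrow> Z' w"
  then show "V Z'" by (intro V_lim[of Z B Z']) simp_all
next
  show "F \<in> borel_measurable config_borel" by (rule F)
  show "\<bar>F w\<bar> \<le> C" if "w \<in> space config_borel" for w using that F by simp
qed (rule V_add V_scale; assumption)+

lemma bounded_convergence_config: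
  fixes Z :: "nat \<Rightarrow> 'a::metric_space set \<Rightarrow> real"
  assumes P: "prob_space P" "sets P = sets config_borel"
    and Z: "\<And>n. Z n \<in> borel_measurable config_borel" "\<And>n w. w \<in> configurations \<Longrightarrow> \<bar>Z n w\<bar> \<le> B"
      "\<And>w. w \<in> configurations \<Longrightarrow> (\<lambda>n. Z n w) \<longlonglongrightarrow> Z' w"
  shows "(\<lambda>n. \<integral>\<omega>. Z n \<omega> \<partial>P) \<longlonglongrightarrow> (\<integral>\<omega>. Z' \<omega> \<partial>P)"
proof -
  interpret P: prob_space P by fact
  have space: "space P = configurations" using P(2) by (metis sets_eq_imp_space_eq space_config_borel)
  have "Z' \<in> borel_measurable config_borel"
    by (rule borel_measurable_LIMSEQ_real[of _ Z]) (use Z in auto)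
  then show ?thesis
    using P(2) Z space
    by (intro integral_dominated_convergence[where w = "\<lambda>_. B"])
      (auto cong: measurable_cong_sets intro!: AE_I2)
qed

lemma abs_integral_le_bound:
  fixes Z :: "'a::metric_space set \<Rightarrow> real"
  assumes P: "prob_space P" "sets P = sets config_borel"
    and Z: "Z \<in> borel_measurable config_borel" "\<And>w. w \<in> configurations \<Longrightarrow> \<bar>Z w\<bar> \<le> B"
  shows "\<bar>\<integral>\<omega>. Z \<omega> \<partial>P\<bar> \<le> B"
proof -
  interpret P: prob_space P by fact
  have space: "space P = configurations" using P(2) by (metis sets_eq_imp_space_eq space_config_borel)
  have "\<bar>\<integral>\<omega>. Z \<omega> \<partial>P\<bar> \<le> (\<integral>\<omega>. \<bar>Z \<omega>\<bar> \<partial>P)" by (rule integral_abs_bound)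
  also have "\<dots> \<le> B"
    using integrable_bounded_config[OF P Z] Z(2) space by (intro P.integral_le_const) (auto intro!: AE_I2)
  finally show ?thesis .
qed

text \<open>The identity is linear in the integrand and stable under bounded convergence on both sides. A
  degenerate \<open>p\<close> gives the uniqueness of a law with given Laplace functional.\<close>

lemma integral_mixture_if_laplace_mixture:
  fixes p :: "nat pmf" and P :: "'a::metric_space set measure" and F :: "'a set \<Rightarrow> real"
  assumes \<sigma>: "sigma_compact (UNIV :: 'a set)"
    and P: "prob_space P" "sets P = sets config_borel"
    and Q: "\<And>n. prob_space (Q n)" "\<And>n. sets (Q n) = sets config_borel"
    and laplace: "\<And>f. f \<in> nonneg_test_functions \<Longrightarrow>
      (\<integral>\<omega>. config_laplace f \<omega> \<partial>P) = (\<integral>n. (\<integral>\<omega>. config_laplace f \<omega> \<partial>Q n) \<partial>p)"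
    and F: "F \<in> borel_measurable config_borel" "\<And>\<omega>. \<omega> \<in> configurations \<Longrightarrow> \<bar>F \<omega>\<bar> \<le> C"
  shows "(\<integral>\<omega>. F \<omega> \<partial>P) = (\<integral>n. (\<integral>\<omega>. F \<omega> \<partial>Q n) \<partial>p)"
proof -
  define V where "V Z \<longleftrightarrow> Z \<in> borel_measurable config_borel \<and> (\<exists>C. \<forall>\<omega>\<in>configurations. \<bar>Z \<omega>\<bar> \<le> C) \<and>
    (\<integral>\<omega>. Z \<omega> \<partial>P) = (\<integral>n. (\<integral>\<omega>. Z \<omega> \<partial>Q n) \<partial>p)" for Z :: "'a set \<Rightarrow> real"
  have int_p: "integrable p (\<lambda>n. \<integral>\<omega>. Z \<omega> \<partial>Q n)"
    if "Z \<in> borel_measurable config_borel" "\<And>\<omega>. \<omega> \<in> configurations \<Longrightarrow> \<bar>Z \<omega>\<bar> \<le> C"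
    for Z :: "'a set \<Rightarrow> real" and C
    using abs_integral_le_bound[OF Q that] by (intro measure_pmf.integrable_const_bound[of _ C]) auto
  have "V F"
  proof (rule config_monotone_class[OF \<sigma> _ _ _ _ F, of V])
    show "V (config_laplace f)" if "f \<in> nonneg_test_functions" for f
      unfolding V_def using laplace[OF that] config_laplace_bounds[OF that]
        config_laplace_measurable nonneg_test_functionsD(1)[OF that]
      by (auto intro!: exI[of _ 1])
  next
    fix Y Z assume "V Y" "V Z"
    then obtain C D where Y: "Y \<in> borel_measurable config_borel" "\<And>\<omega>. \<omega> \<in> configurations \<Longrightarrow> \<bar>Y \<omega>\<bar> \<le> C"
      and Z: "Z \<in> borel_measurable config_borel" "\<And>\<omega>. \<omega> \<in> configurations \<Longrightarrow> \<bar>Z \<omega>\<bar> \<le> D"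
      and eq: "(\<integral>\<omega>. Y \<omega> \<partial>P) = (\<integral>n. (\<integral>\<omega>. Y \<omega> \<partial>Q n) \<partial>p)" "(\<integral>\<omega>. Z \<omega> \<partial>P) = (\<integral>n. (\<integral>\<omega>. Z \<omega> \<partial>Q n) \<partial>p)"
      unfolding V_def by blast
    have "\<bar>Y \<omega> + Z \<omega>\<bar> \<le> C + D" if "\<omega> \<in> configurations" for \<omega>
      using Y(2)[OF that] Z(2)[OF that] by linarith
    then show "V (\<lambda>\<omega>. Y \<omega> + Z \<omega>)"
      unfolding V_def using Y(1) Z(1) eq int_p[OF Y] int_p[OF Z]
        integrable_bounded_config[OF P Y] integrable_bounded_config[OF P Z]
        integrable_bounded_config[OF Q Y] integrable_bounded_config[OF Q Z]
      by auto
  next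
    fix c Z assume "V Z"
    then obtain D where Z: "Z \<in> borel_measurable config_borel" "\<And>\<omega>. \<omega> \<in> configurations \<Longrightarrow> \<bar>Z \<omega>\<bar> \<le> D"
      and eq: "(\<integral>\<omega>. Z \<omega> \<partial>P) = (\<integral>n. (\<integral>\<omega>. Z \<omega> \<partial>Q n) \<partial>p)"
      unfolding V_def by blast
    have "\<bar>c * Z \<omega>\<bar> \<le> \<bar>c\<bar> * D" if "\<omega> \<in> configurations" for \<omega>
      using Z(2)[OF that] by (simp add: abs_mult mult_left_mono)
    then show "V (\<lambda>\<omega>. c * Z \<omega>)"
      unfolding V_def using Z(1) eq by auto
  next
    fix Z Z' B
    assume V: "\<And>n. V (Z n)" and B: "\<And>n w. w \<in> configurations \<Longrightarrow> \<bar>Z n w\<bar> \<le> B"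
      and lim: "\<And>w. w \<in> configurations \<Longrightarrow> (\<lambda>n::nat. Z n w) \<longlonglongrightarrow> Z' w"
    have Z: "\<And>n. Z n \<in> borel_measurable config_borel" using V by (simp add: V_def)
    have Z': "Z' \<in> borel_measurable config_borel"
      by (rule borel_measurable_LIMSEQ_real[of _ Z]) (use Z lim in auto)
    have bound: "\<bar>Z' w\<bar> \<le> B" if "w \<in> configurations" for w
      using LIMSEQ_le_const2[OF tendsto_rabs[OF lim[OF that]], of B] B[OF that] by auto
    have "(\<lambda>k. \<integral>n. (\<integral>\<omega>. Z k \<omega> \<partial>Q n) \<partial>p) \<longlonglongrightarrow> (\<integral>n. (\<integral>\<omega>. Z' \<omega> \<partial>Q n) \<partial>p)"
      using bounded_convergence_config[OF Q Z B lim] abs_integral_le_bound[OF Q Z B]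
      by (intro integral_dominated_convergence[where w = "\<lambda>_. B"]) auto
    moreover have "(\<lambda>k. \<integral>\<omega>. Z k \<omega> \<partial>P) \<longlonglongrightarrow> (\<integral>\<omega>. Z' \<omega> \<partial>P)"
      by (rule bounded_convergence_config[OF P Z B lim])
    ultimately show "V Z'"
      unfolding V_def using V Z' bound by (auto simp: V_def intro: LIMSEQ_unique)
  qed
  then show ?thesis by (simp add: V_def)
qed

section \<open>Poisson measures\<close>

lemma diffuse_radonD:
  assumes "m \<in> diffuse_radon"
  shows "sets m = sets borel" "compact K \<Longrightarrow> emeasure m K < \<infinity>" "emeasure m {x} = 0"
    "A \<in> sets borel \<Longrightarrow> emeasure m A = (SUP K\<in>{K. compact K \<and> K \<subseteq> A}. emeasure m K)"
  using assms by (auto simp: diffuse_radon_def)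

lemma compactly_supported_integrable:
  fixes u :: "'a::metric_space \<Rightarrow> real"
  assumes m: "m \<in> diffuse_radon" and u: "u \<in> compactly_supported"
  shows "integrable m u"
proof -
  obtain K where K: "compact K" "\<And>x. u x \<noteq> 0 \<Longrightarrow> x \<in> K"
    using compactly_supportedE[OF u] by blast
  obtain B where B: "\<And>x. \<bar>u x\<bar> \<le> B" using compactly_supported_bounded[OF u] by blast
  have "u \<in> borel_measurable m"
    using compactly_supported_borel[OF u] by (simp add: diffuse_radonD(1)[OF m] cong: measurable_cong_sets)
  then show ?thesis
    using K B diffuse_radonD(1,2)[OF m] compact_imp_closed[OF K(1)]
    by (intro integrableI_bounded_set[where A = K and B = B]) (auto intro!: AE_I2)
qed

lemma compactly_supported_exp_minus_one:
  fixes f :: "'a::metric_space \<Rightarrow> real"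
  shows
  "f \<in> compactly_supported \<Longrightarrow> (\<lambda>x. exp (- f x) - 1) \<in> compactly_supported"
  by (rule compactly_supported_compose[where \<phi> = "\<lambda>u. exp (- u) - 1"]) (auto intro!: continuous_intros)

lemma is_poissonD:
  assumes "is_poisson m P"
  shows "prob_space P" "sets P = sets config_borel"
    "f \<in> nonneg_test_functions \<Longrightarrow>
      (\<integral>\<omega>. config_laplace f \<omega> \<partial>P) = exp (\<integral>x. (exp (- f x) - 1) \<partial>m)"
proof -
  show "prob_space P" "sets P = sets config_borel" using assms by (auto simp: is_poisson_def)
  assume "f \<in> nonneg_test_functions"
  then have neg: "(\<lambda>x. - f x) \<in> compactly_supported"
    by (intro compactly_supported_compose[where \<phi> = uminus])
      (auto simp: nonneg_test_functions_def intro!: continuous_intros)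
  have all: "\<forall>f\<in>compactly_supported.
      (\<integral>\<omega>. exp (\<integral>x. f x \<partial>config_measure \<omega>) \<partial>P) = exp (\<integral>x. (exp (f x) - 1) \<partial>m)"
    using assms unfolding is_poisson_def by (elim conjE)
  show "(\<integral>\<omega>. config_laplace f \<omega> \<partial>P) = exp (\<integral>x. (exp (- f x) - 1) \<partial>m)"
    using bspec[OF all neg] by (simp add: config_laplace_def)
qed

text \<open>Test functions \<open>f\<^sub>n\<close> with \<open>f\<^sub>n x = 1\<close> that decrease to the indicator of \<open>{x}\<close> give Laplace functionals
  \<open>exp (\<integral>(exp (- f\<^sub>n) - 1) dm)\<close>, which tend to 1 because \<open>m\<close> does not charge \<open>{x}\<close>. On the other hand each
  of them is at most \<open>1 - (1 - exp (- 1)) p\<close>, where \<open>p\<close> is the probability that \<open>x \<in> \<omega>\<close>.\<close>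

lemma poisson_no_fixed_points:
  fixes m :: "'a::metric_space measure"
  assumes \<sigma>: "sigma_compact (UNIV :: 'a set)" and m: "m \<in> diffuse_radon" and P: "is_poisson m P"
  shows "no_fixed_points P"
  unfolding no_fixed_points_def
proof (intro conjI ballI)
  show "prob_space P" "sets P = sets config_borel" by (rule is_poissonD[OF P])+
  interpret P: prob_space P by fact
  have space: "space P = configurations"
    using is_poissonD(2)[OF P] by (metis sets_eq_imp_space_eq space_config_borel)
  fix x :: 'a assume x: "x \<in> compact_part"
  then obtain W K where W: "open W" "compact K" "W \<subseteq> K" "x \<in> W" unfolding compact_part_def by blast
  obtain r where "0 < r" "ball x r \<subseteq> W" using openE[OF W(1,4)] by blast
  with W(3) have r: "0 < r" "ball x r \<subseteq> K" by auto
  obtain N where N: "inverse (real (Suc N)) < r" using reals_Archimedean[OF r(1)] by blast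
  define f where "f n y = max 0 (1 - real (Suc (n + N)) * dist x y)" for n y
  have f_supp: "y \<in> K" if "f n y \<noteq> 0" for n y
  proof -
    have "real (Suc (n + N)) * dist x y < 1" using that by (simp add: f_def max_def split: if_splits)
    moreover have "real (Suc N) * dist x y \<le> real (Suc (n + N)) * dist x y"
      by (intro mult_right_mono) auto
    ultimately have "real (Suc N) * dist x y < 1" by linarith
    then have "dist x y < inverse (real (Suc N))" by (simp add: field_simps del: of_nat_Suc)
    then show ?thesis using N r(2) by (intro subsetD[OF r(2)]) simp
  qed
  have f: "f n \<in> nonneg_test_functions" for n
  proof -
    have "f n \<in> compactly_supported"
    proof (rule compactly_supportedI[OF _ W(2) f_supp])
      show "continuous_on UNIV (f n)" unfolding f_def by (intro continuous_intros)
    qed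
    then show ?thesis by (simp add: nonneg_test_functions_def f_def)
  qed
  have f_lim: "(\<lambda>n. f n y) \<longlonglongrightarrow> 0" if "y \<noteq> x" for y
  proof -
    have pos: "0 < dist x y" using that by simp
    obtain M where M: "1 < real M * dist x y" using reals_Archimedean3[OF pos] by auto
    have "f n y = 0" if "M \<le> n" for n
    proof -
      have "real M * dist x y \<le> real (Suc (n + N)) * dist x y" using that pos by (intro mult_right_mono) auto
      then show ?thesis using M by (simp add: f_def)
    qed
    then show ?thesis by (intro tendsto_eventually eventually_sequentiallyI[of M])
  qed
  have sets_m: "sets m = sets borel" by (rule diffuse_radonD(1)[OF m])
  have K_sets: "K \<in> sets m" using compact_imp_closed[OF W(2)] sets_m by auto
  have "(\<lambda>n. \<integral>y. (exp (- f n y) - 1) \<partial>m) \<longlonglongrightarrow> (\<integral>y. 0 \<partial>m)"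
  proof (rule integral_dominated_convergence[where w = "indicator K"])
    show "(\<lambda>y. exp (- f n y) - 1) \<in> borel_measurable m" for n
      using compactly_supported_borel[OF compactly_supported_exp_minus_one[OF nonneg_test_functionsD(1)[OF f]]]
        sets_m by (simp cong: measurable_cong_sets)
    show "integrable m (indicator K :: 'a \<Rightarrow> real)"
      using K_sets diffuse_radonD(2)[OF m W(2)] by simp
    have "AE y in m. y \<noteq> x"
      by (rule AE_I[of _ _ "{x}"]) (auto simp: diffuse_radonD(3)[OF m] sets_m)
    then show "AE y in m. (\<lambda>n. exp (- f n y) - 1) \<longlonglongrightarrow> 0"
    proof eventually_elim
      fix y assume "y \<noteq> x"
      then have "(\<lambda>n. exp (- f n y) - 1) \<longlonglongrightarrow> exp (- 0) - 1"
        by (intro tendsto_intros f_lim)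
      then show "(\<lambda>n. exp (- f n y) - 1) \<longlonglongrightarrow> 0" by simp
    qed
    show "AE y in m. norm (exp (- f n y) - 1) \<le> indicator K y" for n
    proof (rule AE_I2)
      fix y
      have "0 \<le> f n y" by (simp add: f_def)
      then show "norm (exp (- f n y) - 1) \<le> indicator K y"
        using f_supp[of n y] by (cases "f n y = 0") (auto simp: indicator_def)
    qed
  qed simp
  then have "(\<lambda>n. exp (\<integral>y. (exp (- f n y) - 1) \<partial>m)) \<longlonglongrightarrow> exp 0"
    by (intro tendsto_exp) simp
  then have lim: "(\<lambda>n. \<integral>\<omega>. config_laplace (f n) \<omega> \<partial>P) \<longlonglongrightarrow> 1"
    by (simp add: is_poissonD(3)[OF P f])
  have D_sets: "{\<omega> \<in> configurations. x \<in> \<omega>} \<in> sets P"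
  proof -
    have "Pair x -` {(x, \<omega>). x \<in> compact_part \<and> x \<in> \<omega> \<and> \<omega> \<in> configurations} \<in> sets config_borel"
      by (rule sets_Pair1[OF point_in_config_sets[OF \<sigma>]])
    then show ?thesis using x is_poissonD(2)[OF P] by (simp add: vimage_def conj_commute)
  qed
  define p where "p = P.prob {\<omega> \<in> configurations. x \<in> \<omega>}"
  have le: "(\<integral>\<omega>. config_laplace (f n) \<omega> \<partial>P) \<le> 1 - (1 - exp (-1)) * p" for n
  proof -
    have "(\<integral>\<omega>. config_laplace (f n) \<omega> \<partial>P)
      \<le> (\<integral>\<omega>. 1 - (1 - exp (-1)) * indicator {\<omega> \<in> configurations. x \<in> \<omega>} \<omega> \<partial>P)"
    proof (rule integral_mono)
      show "integrable P (config_laplace (f n))"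
        by (rule integrable_bounded_config[OF is_poissonD(1,2)[OF P], of _ 1])
          (use config_laplace_bounds[OF f] config_laplace_measurable[OF nonneg_test_functionsD(1)[OF f]] in auto)
      show "integrable P (\<lambda>\<omega>. 1 - (1 - exp (-1)) * indicator {\<omega> \<in> configurations. x \<in> \<omega>} \<omega> :: real)"
        using D_sets by (intro Bochner_Integration.integrable_diff integrable_mult_right) (auto simp: P.emeasure_eq_measure)
      fix \<omega> assume "\<omega> \<in> space P"
      then have \<omega>: "\<omega> \<in> configurations" by (simp add: space)
      show "config_laplace (f n) \<omega> \<le> 1 - (1 - exp (-1)) * indicator {\<omega> \<in> configurations. x \<in> \<omega>} \<omega>"
      proof (cases "x \<in> \<omega>")
        case True
        let ?A = "{y \<in> \<omega>. f n y \<noteq> 0}"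
        have fin: "finite ?A" by (rule config_support_finite[OF \<omega> nonneg_test_functionsD(1)[OF f]])
        have "f n x = 1" by (simp add: f_def)
        then have "1 \<le> (\<Sum>y\<in>?A. f n y)"
          using member_le_sum[of x ?A "f n"] fin True by (simp add: nonneg_test_functionsD(2)[OF f])
        also have "\<dots> = (\<integral>y. f n y \<partial>config_measure \<omega>)"
          using fin by (intro integral_config_measure[OF nonneg_test_functionsD(1)[OF f], symmetric]) auto
        finally show ?thesis using True \<omega> by (simp add: config_laplace_def)
      next
        case False
        then show ?thesis using config_laplace_bounds[OF f, of n \<omega>] by simp
      qed
    qed
    also have "\<dots> = 1 - (1 - exp (-1)) * p"
      using D_sets by (simp add: p_def P.prob_space P.emeasure_eq_measure)
    finally show ?thesis .
  qed
  have "1 \<le> 1 - (1 - exp (-1)) * p"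
    by (rule LIMSEQ_le_const2[OF lim]) (use le in auto)
  then have "(1 - exp (-1)) * p \<le> 0" by linarith
  moreover have "(0::real) < 1 - exp (-1)" by simp
  ultimately have "p \<le> 0" using mult_le_0_iff by (metis not_less order_less_imp_le)
  then have "p = 0" using measure_nonneg[of P] unfolding p_def by (metis antisym)
  then have "emeasure P {\<omega> \<in> configurations. x \<in> \<omega>} = 0"
    by (simp add: p_def P.emeasure_eq_measure)
  then show "AE \<omega> in P. x \<notin> \<omega>"
    using D_sets by (intro AE_I[of _ _ "{\<omega> \<in> configurations. x \<in> \<omega>}"]) (auto simp: space)
qed

section \<open>Comparison of two Poisson measures\<close>

lemma emeasure_density_singleton:
  assumes "x \<in> space \<nu>" "{x} \<in> sets \<nu>" "a \<in> borel_measurable \<nu>"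
  shows "emeasure (density \<nu> a) {x} = a x * emeasure \<nu> {x}"
  using assms by (simp add: emeasure_density nn_integral_indicator_singleton)

text \<open>With \<open>t = \<integral>(b - a) d\<nu>\<close> and points of law \<open>(b - a) \<nu> / t\<close>, the configuration of intensity \<open>b \<nu>\<close> is
  obtained from that of intensity \<open>a \<nu>\<close> by adding a Poisson number of points of mean \<open>t\<close>: the Laplace
  functional of a single point is \<open>c\<close> with \<open>t (c - 1) = \<integral>(exp (- f) - 1) (b - a) d\<nu>\<close>, and the generating
  function of the Poisson distribution turns it into \<open>exp (t (c - 1))\<close>. The bound is the expected
  number of added points. Both intensities are densities with respect to one \<open>\<nu>\<close> so that differences
  of intensities are differences of functions.\<close>

lemma poisson_density_Lip1:
  fixes \<nu> :: "'a::metric_space measure" and a b :: "'a \<Rightarrow> real"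
  assumes \<sigma>: "sigma_compact (UNIV :: 'a set)" and \<nu>: "sets \<nu> = sets borel"
    and a: "a \<in> borel_measurable borel" "\<And>x. 0 \<le> a x"
    and b: "b \<in> borel_measurable borel" "\<And>x. a x \<le> b x"
    and radon: "density \<nu> a \<in> diffuse_radon" "density \<nu> b \<in> diffuse_radon"
    and int: "integrable \<nu> (\<lambda>x. b x - a x)"
    and P: "is_poisson (density \<nu> a) P" and Q: "is_poisson (density \<nu> b) Q"
    and F: "F \<in> rho1_Lip1"
  shows "\<bar>(\<integral>\<omega>. F \<omega> \<partial>Q) - (\<integral>\<omega>. F \<omega> \<partial>P)\<bar> \<le> (\<integral>x. b x - a x \<partial>\<nu>)"
proof -
  define t where "t = (\<integral>x. b x - a x \<partial>\<nu>)"
  have t0: "0 \<le> t" unfolding t_def using b by (intro Bochner_Integration.integral_nonneg) auto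
  obtain C where C: "\<And>\<omega>. \<omega> \<in> configurations \<Longrightarrow> \<bar>F \<omega>\<bar> \<le> C"
    using rho1_Lip1_bounded[OF F] by blast
  note mF = rho1_Lip1_measurable[OF F]
  have [measurable]: "a \<in> borel_measurable \<nu>" "b \<in> borel_measurable \<nu>"
    using a b \<nu> by (auto cong: measurable_cong_sets)
  have b0: "0 \<le> b x" for x using a(2)[of x] b(2)[of x] by simp
  have laplace: "(\<integral>\<omega>. config_laplace f \<omega> \<partial>Q)
      = (\<integral>\<omega>. config_laplace f \<omega> \<partial>P) * exp (\<integral>x. (b x - a x) * (exp (- f x) - 1) \<partial>\<nu>)"
    if f: "f \<in> nonneg_test_functions" for f
  proof -
    let ?u = "\<lambda>x. exp (- f x) - 1"
    have u: "?u \<in> compactly_supported"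
      by (rule compactly_supported_exp_minus_one[OF nonneg_test_functionsD(1)[OF f]])
    have [measurable]: "?u \<in> borel_measurable \<nu>"
      using compactly_supported_borel[OF u] \<nu> by (simp cong: measurable_cong_sets)
    have ia: "integrable \<nu> (\<lambda>x. a x * ?u x)"
      using compactly_supported_integrable[OF radon(1) u] a by (subst (asm) integrable_density) auto
    have ib: "integrable \<nu> (\<lambda>x. b x * ?u x)"
      using compactly_supported_integrable[OF radon(2) u] b0 by (subst (asm) integrable_density) auto
    have "(\<integral>\<omega>. config_laplace f \<omega> \<partial>Q) = exp (\<integral>x. b x * ?u x \<partial>\<nu>)"
      using b0 by (simp add: is_poissonD(3)[OF Q f] integral_density)
    also have "(\<integral>x. b x * ?u x \<partial>\<nu>) = (\<integral>x. a x * ?u x \<partial>\<nu>) + (\<integral>x. (b x - a x) * ?u x \<partial>\<nu>)"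
      using ia ib by (simp add: left_diff_distrib)
    also have "exp \<dots> = (\<integral>\<omega>. config_laplace f \<omega> \<partial>P) * exp (\<integral>x. (b x - a x) * ?u x \<partial>\<nu>)"
      using a by (simp add: is_poissonD(3)[OF P f] integral_density exp_add)
    finally show ?thesis .
  qed
  show ?thesis
  \<comment> \<open>For \<open>t = 0\<close> there is no law of the added points, but then both Laplace functionals agree.\<close>
  proof (cases "t = 0")
    case True
    have "AE x in \<nu>. b x - a x = 0"
      using int b(2) True unfolding t_def by (subst (asm) integral_nonneg_eq_0_iff_AE) auto
    then have zero: "(\<integral>x. (b x - a x) * (exp (- f x) - 1) \<partial>\<nu>) = 0" for f :: "'a \<Rightarrow> real"
      by (intro integral_eq_zero_AE) auto
    have "(\<integral>\<omega>. F \<omega> \<partial>Q) = (\<integral>n. (\<integral>\<omega>. F \<omega> \<partial>P) \<partial>return_pmf (0::nat))"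
      by (rule integral_mixture_if_laplace_mixture[OF \<sigma> is_poissonD(1,2)[OF Q] is_poissonD(1,2)[OF P] _ mF C])
        (simp_all add: laplace zero)
    then show ?thesis using t0 by (simp add: t_def)
  next
    case False
    with t0 have t: "0 < t" by simp
    define B where "B = density \<nu> (\<lambda>x. ennreal ((b x - a x) / t))"
    have nn: "(\<integral>\<^sup>+x. ennreal ((b x - a x) / t) \<partial>\<nu>) = 1"
    proof -
      have "(\<integral>\<^sup>+x. ennreal ((b x - a x) / t) \<partial>\<nu>) = ennreal (\<integral>x. (b x - a x) / t \<partial>\<nu>)"
        using int b t by (intro nn_integral_eq_integral) auto
      then show ?thesis using t by (simp add: t_def[symmetric])
    qed
    have prob_B: "prob_space B"
      unfolding B_def using nn by (intro prob_spaceI) (simp add: emeasure_density cong: nn_integral_cong)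
    interpret B: diffuse_prob B
    proof (intro diffuse_prob.intro[OF prob_B] diffuse_prob_axioms.intro)
      show "sigma_compact (UNIV :: 'a set)" by (rule \<sigma>)
      show "sets B = sets borel" by (simp add: B_def \<nu>)
      fix x :: 'a
      have x: "x \<in> space \<nu>" "{x} \<in> sets \<nu>" using sets_eq_imp_space_eq[OF \<nu>] \<nu> by auto
      have "ennreal (b x) * emeasure \<nu> {x} = 0"
        using diffuse_radonD(3)[OF radon(2), of x] x
        by (subst (asm) emeasure_density_singleton) auto
      then have "b x = 0 \<or> emeasure \<nu> {x} = 0" using b0[of x] by auto
      then have "b x - a x = 0 \<or> emeasure \<nu> {x} = 0" using a(2)[of x] b(2)[of x] by auto
      then show "emeasure B {x} = 0"
        unfolding B_def using x by (subst emeasure_density_singleton) auto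
    qed
    have nfp: "no_fixed_points P" by (rule poisson_no_fixed_points[OF \<sigma> radon(1) P])
    let ?Q = "\<lambda>n. (B.add_point ^^ n) P"
    have Qn: "prob_space (?Q n)" "sets (?Q n) = sets config_borel" for n
      using no_fixed_pointsD[OF B.no_fixed_points_funpow[OF nfp]] by auto
    have eq: "(\<integral>\<omega>. F \<omega> \<partial>Q) = (\<integral>n. (\<integral>\<omega>. F \<omega> \<partial>?Q n) \<partial>poisson_pmf t)"
    proof (rule integral_mixture_if_laplace_mixture[OF \<sigma> is_poissonD(1,2)[OF Q] Qn _ mF C])
      fix f :: "'a \<Rightarrow> real" assume f: "f \<in> nonneg_test_functions"
      define c where "c = (\<integral>x. exp (- f x) \<partial>B)"
      have fm: "f \<in> borel_measurable borel"
        by (rule compactly_supported_borel[OF nonneg_test_functionsD(1)[OF f]])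
      then have [measurable]: "f \<in> borel_measurable \<nu>" "f \<in> borel_measurable B"
        using \<nu> B.sets_B by (simp_all cong: measurable_cong_sets)
      have iB: "integrable B (\<lambda>x. exp (- f x))"
        by (rule B.integrable_const_bound[of _ 1]) (auto simp: nonneg_test_functionsD(2)[OF f])
      have "c - 1 = (\<integral>x. exp (- f x) - 1 \<partial>B)"
        using iB by (simp add: c_def B.prob_space)
      also have "\<dots> = (\<integral>x. (b x - a x) / t * (exp (- f x) - 1) \<partial>\<nu>)"
        unfolding B_def using b t by (subst integral_density) auto
      also have "\<dots> = (\<integral>x. (b x - a x) * (exp (- f x) - 1) \<partial>\<nu>) / t"
        by (simp add: field_simps)
      finally have "(\<integral>x. (b x - a x) * (exp (- f x) - 1) \<partial>\<nu>) = t * (c - 1)"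
        using t by (simp add: field_simps)
      moreover have "0 \<le> c" unfolding c_def by (intro Bochner_Integration.integral_nonneg) auto
      ultimately show "(\<integral>\<omega>. config_laplace f \<omega> \<partial>Q)
        = (\<integral>n. (\<integral>\<omega>. config_laplace f \<omega> \<partial>?Q n) \<partial>poisson_pmf t)"
        using t by (simp add: laplace[OF f] B.integral_laplace_funpow[OF nfp f] c_def[symmetric]
            poisson_pmf_generating_function)
    qed
    let ?d = "\<lambda>n. (\<integral>\<omega>. F \<omega> \<partial>?Q n) - (\<integral>\<omega>. F \<omega> \<partial>P)"
    have d: "\<bar>?d n\<bar> \<le> real n" for n by (rule B.add_points_Lip1[OF nfp F])
    have i: "integrable (poisson_pmf t) (\<lambda>n. \<integral>\<omega>. F \<omega> \<partial>?Q n)"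
      using abs_integral_le_bound[OF Qn mF C] by (intro measure_pmf.integrable_const_bound[of _ C]) auto
    have "(\<integral>\<omega>. F \<omega> \<partial>Q) - (\<integral>\<omega>. F \<omega> \<partial>P) = (\<integral>n. ?d n \<partial>poisson_pmf t)"
      using i by (simp add: eq)
    also have "\<bar>\<dots>\<bar> \<le> (\<integral>n. \<bar>?d n\<bar> \<partial>poisson_pmf t)" by (rule integral_abs_bound)
    also have "\<dots> \<le> (\<integral>n. real n \<partial>poisson_pmf t)"
      using i d poisson_pmf_mean(1)[OF t] by (intro integral_mono) auto
    also have "\<dots> = t" by (rule poisson_pmf_mean(2)[OF t])
    finally show ?thesis by (simp add: t_def)
  qed
qed

lemma sigma_compact_exhaustion:
  assumes "sigma_compact (UNIV :: 'a::topological_space set)"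
  obtains K :: "nat \<Rightarrow> 'a::topological_space set" where "\<And>n. compact (K n)" "incseq K" "(\<Union>n. K n) = UNIV"
proof -
  obtain \<C> :: "'a set set" where \<C>: "countable \<C>" "\<And>K. K \<in> \<C> \<Longrightarrow> compact K" "\<Union>\<C> = UNIV"
    using assms unfolding sigma_compact_def by blast
  have ne: "\<C> \<noteq> {}" using \<C>(3) by auto
  define K where "K n = (\<Union>i\<le>n. from_nat_into \<C> i)" for n
  show ?thesis
  proof (rule that[of K])
    show "compact (K n)" for n
      unfolding K_def using \<C>(2) from_nat_into[OF ne] by (intro compact_UN) auto
    show "incseq K" unfolding K_def incseq_def by (auto intro: order_trans)
    have "\<Union>\<C> = (\<Union>i. from_nat_into \<C> i)" using range_from_nat_into[OF ne \<C>(1)] by simp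
    also have "\<dots> \<subseteq> (\<Union>n. K n)" unfolding K_def by blast
    finally show "(\<Union>n. K n) = UNIV" using \<C>(3) by auto
  qed
qed

lemma diffuse_radon_sigma_finite:
  fixes m :: "'a::metric_space measure"
  assumes \<sigma>: "sigma_compact (UNIV :: 'a set)" and m: "m \<in> diffuse_radon"
  shows "sigma_finite_measure m"
proof
  obtain K :: "nat \<Rightarrow> 'a set" where K: "\<And>n. compact (K n)" "incseq K" "(\<Union>n. K n) = UNIV"
    using sigma_compact_exhaustion[OF \<sigma>] by blast
  have "K n \<in> sets m" for n using compact_imp_closed[OF K(1)] diffuse_radonD(1)[OF m] by auto
  moreover have "space m = UNIV" using sets_eq_imp_space_eq[OF diffuse_radonD(1)[OF m]] by simp
  ultimately show "\<exists>A. countable A \<and> A \<subseteq> sets m \<and> \<Union>A = space m \<and> (\<forall>a\<in>A. emeasure m a \<noteq> \<infinity>)"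
    using K diffuse_radonD(2)[OF m K(1)] by (intro exI[of _ "range K"]) (auto simp: less_top)
qed

text \<open>Only inner regularity is at stake. On a set of finite \<open>m\<close>-measure, a compact subset that exhausts \<open>m\<close> up
  to \<open>\<epsilon>\<close> also exhausts the smaller measure \<open>n\<close> up to \<open>\<epsilon>\<close>; intersecting with a compact exhaustion of the
  space reduces the general case to this one. It is applied to the common part of two intensities,
  which thereby has a Poisson measure.\<close>

lemma diffuse_radon_mono:
  fixes m n :: "'a::metric_space measure"
  assumes \<sigma>: "sigma_compact (UNIV :: 'a set)" and m: "m \<in> diffuse_radon"
    and n: "sets n = sets borel" and le: "\<And>A. A \<in> sets borel \<Longrightarrow> emeasure n A \<le> emeasure m A"
  shows "n \<in> diffuse_radon"
  unfolding diffuse_radon_def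
proof (intro CollectI conjI allI impI ballI)
  show "sets n = sets borel" by (rule n)
  show "emeasure n K < \<infinity>" if "compact K" for K
    using le[of K] diffuse_radonD(2)[OF m that] compact_imp_closed[OF that] by (auto intro: le_less_trans)
  show "emeasure n {x} = 0" for x using le[of "{x}"] diffuse_radonD(3)[OF m, of x] by simp
  fix A :: "'a set" assume A: "A \<in> sets borel"
  let ?S = "SUP K\<in>{K. compact K \<and> K \<subseteq> A}. emeasure n K"
  have borel: "K \<in> sets borel" if "compact K" for K :: "'a set" using compact_imp_closed[OF that] by auto
  show "emeasure n A = ?S"
  proof (rule antisym)
    show "?S \<le> emeasure n A"
      using A n by (intro SUP_least) (auto intro!: emeasure_mono)
    obtain K :: "nat \<Rightarrow> 'a set" where K: "\<And>i. compact (K i)" "incseq K" "(\<Union>i. K i) = UNIV"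
      using sigma_compact_exhaustion[OF \<sigma>] by blast
    have "emeasure n (A \<inter> K i) \<le> ?S" for i
    proof (rule ennreal_le_epsilon)
      fix e :: real assume e: "0 < e"
      have AK: "A \<inter> K i \<in> sets borel" using A borel[OF K(1)] by auto
      have fin: "emeasure m (A \<inter> K i) < \<infinity>"
        using emeasure_mono[of "A \<inter> K i" "K i" m] diffuse_radonD(1,2)[OF m] K(1)[of i] borel[OF K(1)]
        by (auto intro: le_less_trans)
      have "\<exists>J\<in>{J. compact J \<and> J \<subseteq> A \<inter> K i}. emeasure m (A \<inter> K i) < emeasure m J + ennreal e"
        using e fin by (intro SUP_approx_ennreal[OF _ _ diffuse_radonD(4)[OF m AK]]) auto
      then obtain J where J: "compact J" "J \<subseteq> A \<inter> K i" "emeasure m (A \<inter> K i) \<le> emeasure m J + e"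
        by (auto dest: less_imp_le)
      have J_sets: "J \<in> sets borel" by (rule borel[OF J(1)])
      have Jfin: "emeasure m J \<noteq> \<infinity>" using diffuse_radonD(2)[OF m J(1)] by auto
      have "emeasure n (A \<inter> K i) = emeasure n J + emeasure n (A \<inter> K i - J)"
        using J(2) J_sets AK n by (subst plus_emeasure) (auto intro!: arg_cong[where f = "emeasure n"])
      also have "\<dots> \<le> emeasure n J + emeasure m (A \<inter> K i - J)"
        using le AK J_sets by (intro add_left_mono) auto
      also have "emeasure m (A \<inter> K i - J) = emeasure m (A \<inter> K i) - emeasure m J"
        using J(2) J_sets AK Jfin diffuse_radonD(1)[OF m] by (intro emeasure_Diff) auto
      also have "\<dots> \<le> e" using J(3) fin by (auto simp: ennreal_minus_le_iff)
      also have "emeasure n J \<le> ?S" using J by (intro SUP_upper) auto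
      finally show "emeasure n (A \<inter> K i) \<le> ?S + ennreal e" by (simp add: add_mono)
    qed
    moreover have "emeasure n A = (SUP i. emeasure n (A \<inter> K i))"
    proof -
      have "(SUP i. emeasure n (A \<inter> K i)) = emeasure n (\<Union>i. A \<inter> K i)"
        using A n borel[OF K(1)] K(2) by (intro SUP_emeasure_incseq) (auto simp: incseq_def, blast)
      also have "(\<Union>i. A \<inter> K i) = A" using K(3) by auto
      finally show ?thesis ..
    qed
    ultimately show "emeasure n A \<le> ?S" by (simp add: SUP_least)
  qed
qed

text \<open>Both \<open>s\<close> and \<open>m = h s\<close> are compared with their common part \<open>min 1 h s\<close>; the two errors add up
  because \<open>(1 - min 1 h) + (h - min 1 h) = \<bar>h - 1\<bar>\<close>.\<close>

lemma poisson_Lip1_RN_deriv: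
  fixes s m :: "'a::metric_space measure"
  assumes \<sigma>: "sigma_compact (UNIV :: 'a set)" and s: "s \<in> diffuse_radon" and m: "m \<in> diffuse_radon"
    and poisson: "\<And>m. m \<in> diffuse_radon \<Longrightarrow> is_poisson m (\<mu> m)"
    and ac: "absolutely_continuous s m"
    and int: "integrable s (\<lambda>x. enn2real (RN_deriv s m x) - 1)"
    and F: "F \<in> rho1_Lip1"
  shows "\<bar>(\<integral>\<omega>. F \<omega> \<partial>\<mu> s) - (\<integral>\<omega>. F \<omega> \<partial>\<mu> m)\<bar> \<le> (\<integral>x. \<bar>enn2real (RN_deriv s m x) - 1\<bar> \<partial>s)"
proof -
  define h where "h x = enn2real (RN_deriv s m x)" for x
  have h0: "0 \<le> h x" for x by (simp add: h_def)
  have sets_s: "sets s = sets borel" and sets_m: "sets m = sets s"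
    using diffuse_radonD(1)[OF s] diffuse_radonD(1)[OF m] by auto
  have hs: "h \<in> borel_measurable s" unfolding h_def by measurable
  then have hm: "h \<in> borel_measurable borel" using sets_s by (simp cong: measurable_cong_sets)
  interpret s: sigma_finite_measure s by (rule diffuse_radon_sigma_finite[OF \<sigma> s])
  have "AE x in s. RN_deriv s m x \<noteq> \<infinity>"
    by (rule s.RN_deriv_finite[OF diffuse_radon_sigma_finite[OF \<sigma> m] ac sets_m])
  then have "AE x in s. ennreal (h x) = RN_deriv s m x"
    by eventually_elim (simp add: h_def less_top)
  then have "density s h = density s (RN_deriv s m)"
    using hs by (intro density_cong) auto
  also have "\<dots> = m" by (rule s.density_RN_deriv[OF ac sets_m])
  finally have dm: "density s h = m" .
  have ds: "density s (\<lambda>_. ennreal 1) = s" by (simp add: density_1)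
  define a where "a x = min 1 (h x)" for x
  have am: "a \<in> borel_measurable borel" unfolding a_def using hm by measurable
  have as [measurable]: "a \<in> borel_measurable s" using am sets_s by (simp cong: measurable_cong_sets)
  have radon: "density s a \<in> diffuse_radon"
  proof (rule diffuse_radon_mono[OF \<sigma> s])
    show "sets (density s a) = sets borel" by (simp add: sets_s)
    fix A :: "'a set" assume "A \<in> sets borel"
    then have "A \<in> sets s" using sets_s by simp
    then have "emeasure (density s a) A \<le> (\<integral>\<^sup>+x. indicator A x \<partial>s)"
      unfolding emeasure_density[OF measurable_compose[OF as measurable_ennreal] \<open>A \<in> sets s\<close>]
      by (intro nn_integral_mono) (auto simp: a_def indicator_def)
    then show "emeasure (density s a) A \<le> emeasure s A" using \<open>A \<in> sets s\<close> by simp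
  qed
  have ih: "integrable s (\<lambda>x. h x - 1)" using int by (simp add: h_def)
  have i1: "integrable s (\<lambda>x. 1 - a x)"
  proof (rule Bochner_Integration.integrable_bound[OF ih])
    show "(\<lambda>x. 1 - a x) \<in> borel_measurable s" by measurable
  qed (use h0 in \<open>auto simp: a_def intro!: AE_I2\<close>)
  have i2: "integrable s (\<lambda>x. h x - a x)"
  proof (rule Bochner_Integration.integrable_bound[OF ih])
    show "(\<lambda>x. h x - a x) \<in> borel_measurable s" using hs by measurable
  qed (use h0 in \<open>auto simp: a_def intro!: AE_I2\<close>)
  have "\<bar>(\<integral>\<omega>. F \<omega> \<partial>\<mu> s) - (\<integral>\<omega>. F \<omega> \<partial>\<mu> (density s a))\<bar> \<le> (\<integral>x. 1 - a x \<partial>s)"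
    using poisson[OF s] s ds h0
    by (intro poisson_density_Lip1[OF \<sigma> sets_s am _ _ _ radon _ i1 poisson[OF radon] _ F])
      (auto simp: a_def)
  moreover have "\<bar>(\<integral>\<omega>. F \<omega> \<partial>\<mu> m) - (\<integral>\<omega>. F \<omega> \<partial>\<mu> (density s a))\<bar> \<le> (\<integral>x. h x - a x \<partial>s)"
    using poisson[OF m] m dm h0
    by (intro poisson_density_Lip1[OF \<sigma> sets_s am _ hm _ radon _ i2 poisson[OF radon] _ F])
      (auto simp: a_def)
  moreover have "(\<integral>x. 1 - a x \<partial>s) + (\<integral>x. h x - a x \<partial>s) = (\<integral>x. \<bar>h x - 1\<bar> \<partial>s)"
  proof -
    have "(\<integral>x. 1 - a x \<partial>s) + (\<integral>x. h x - a x \<partial>s) = (\<integral>x. (1 - a x) + (h x - a x) \<partial>s)"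
      using i1 i2 by (rule Bochner_Integration.integral_add[symmetric])
    also have "\<dots> = (\<integral>x. \<bar>h x - 1\<bar> \<partial>s)" by (intro Bochner_Integration.integral_cong) (auto simp: a_def)
    finally show ?thesis .
  qed
  ultimately show ?thesis by (simp add: h_def)
qed

section \<open>The Poisson measures as a kernel\<close>

lemma space_radon_borel [simp]: "space radon_borel = diffuse_radon"
  by (simp add: radon_borel_def borel_of_def space_measure_of_conv topspace_vague_topology)

lemma integral_radon_measurable:
  assumes "u \<in> compactly_supported"
  shows "(\<lambda>m. \<integral>x. u x \<partial>m) \<in> borel_measurable radon_borel"
proof (rule borel_measurableI)
  fix S :: "real set" assume S: "open S"
  have "openin (vague_topology diffuse_radon (\<lambda>m. m)) {m \<in> diffuse_radon. (\<integral>x. u x \<partial>m) \<in> S}"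
    unfolding vague_topology_def using assms S by (intro topology_generated_by_Basis) blast
  moreover have "{U. openin (vague_topology diffuse_radon (\<lambda>m. m)) U}
      \<subseteq> Pow (topspace (vague_topology diffuse_radon (\<lambda>m. m)))"
    using openin_subset by blast
  ultimately have "{m \<in> diffuse_radon. (\<integral>x. u x \<partial>m) \<in> S} \<in> sets radon_borel"
    unfolding radon_borel_def borel_of_def by (intro in_measure_of) auto
  then show "(\<lambda>m. \<integral>x. u x \<partial>m) -` S \<inter> space radon_borel \<in> sets radon_borel"
    by (simp add: vimage_def Int_def conj_commute)
qed

text \<open>For Laplace variables the integral is \<open>exp (\<integral>(exp (- f) - 1) dm)\<close>, a continuous function of \<open>m\<close> because
  \<open>exp (- f) - 1\<close> is again a test function; the monotone class theorem covers the other integrands.\<close>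

lemma poisson_kernel_integral_measurable:
  fixes \<mu> :: "'a::metric_space measure \<Rightarrow> 'a set measure"
  assumes \<sigma>: "sigma_compact (UNIV :: 'a set)"
    and poisson: "\<And>m. m \<in> diffuse_radon \<Longrightarrow> is_poisson m (\<mu> m)"
    and F: "F \<in> borel_measurable config_borel" "\<And>\<omega>. \<omega> \<in> configurations \<Longrightarrow> \<bar>F \<omega>\<bar> \<le> (C::real)"
  shows "(\<lambda>m. \<integral>\<omega>. F \<omega> \<partial>\<mu> m) \<in> borel_measurable radon_borel"
proof -
  note P = is_poissonD(1,2)[OF poisson]
  define V where "V Z \<longleftrightarrow> Z \<in> borel_measurable config_borel \<and> (\<exists>C. \<forall>\<omega>\<in>configurations. \<bar>Z \<omega>\<bar> \<le> C) \<and>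
    (\<lambda>m. \<integral>\<omega>. Z \<omega> \<partial>\<mu> m) \<in> borel_measurable radon_borel" for Z :: "'a set \<Rightarrow> real"
  have "V F"
  proof (rule config_monotone_class[OF \<sigma> _ _ _ _ F, of V])
    fix f :: "'a \<Rightarrow> real" assume f: "f \<in> nonneg_test_functions"
    note f' = nonneg_test_functionsD(1)[OF f]
    have [measurable]: "(\<lambda>m. \<integral>x. (exp (- f x) - 1) \<partial>m) \<in> borel_measurable radon_borel"
      by (rule integral_radon_measurable[OF compactly_supported_exp_minus_one[OF f']])
    have "(\<lambda>m. exp (\<integral>x. (exp (- f x) - 1) \<partial>m)) \<in> borel_measurable radon_borel"
      by measurable
    then have "(\<lambda>m. \<integral>\<omega>. config_laplace f \<omega> \<partial>\<mu> m) \<in> borel_measurable radon_borel"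
      by (rule measurable_cong[THEN iffD1, rotated]) (simp add: is_poissonD(3)[OF poisson f])
    then show "V (config_laplace f)"
      unfolding V_def using config_laplace_bounds[OF f] config_laplace_measurable[OF f']
      by (auto intro!: exI[of _ 1])
  next
    fix Y Z assume "V Y" "V Z"
    then obtain C D where Y: "Y \<in> borel_measurable config_borel" "\<And>\<omega>. \<omega> \<in> configurations \<Longrightarrow> \<bar>Y \<omega>\<bar> \<le> C"
      and Z: "Z \<in> borel_measurable config_borel" "\<And>\<omega>. \<omega> \<in> configurations \<Longrightarrow> \<bar>Z \<omega>\<bar> \<le> D"
      and [measurable]: "(\<lambda>m. \<integral>\<omega>. Y \<omega> \<partial>\<mu> m) \<in> borel_measurable radon_borel"
        "(\<lambda>m. \<integral>\<omega>. Z \<omega> \<partial>\<mu> m) \<in> borel_measurable radon_borel"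
      unfolding V_def by blast
    have "\<bar>Y \<omega> + Z \<omega>\<bar> \<le> C + D" if "\<omega> \<in> configurations" for \<omega>
      using Y(2)[OF that] Z(2)[OF that] by linarith
    moreover have "(\<lambda>m. (\<integral>\<omega>. Y \<omega> \<partial>\<mu> m) + (\<integral>\<omega>. Z \<omega> \<partial>\<mu> m)) \<in> borel_measurable radon_borel"
      by measurable
    then have "(\<lambda>m. \<integral>\<omega>. Y \<omega> + Z \<omega> \<partial>\<mu> m) \<in> borel_measurable radon_borel"
      by (rule measurable_cong[THEN iffD1, rotated])
        (simp add: integrable_bounded_config[OF P Y] integrable_bounded_config[OF P Z])
    ultimately show "V (\<lambda>\<omega>. Y \<omega> + Z \<omega>)"
      unfolding V_def using Y(1) Z(1) by auto
  next
    fix c Z assume "V Z"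
    then obtain D where Z: "Z \<in> borel_measurable config_borel" "\<And>\<omega>. \<omega> \<in> configurations \<Longrightarrow> \<bar>Z \<omega>\<bar> \<le> D"
      and m: "(\<lambda>m. \<integral>\<omega>. Z \<omega> \<partial>\<mu> m) \<in> borel_measurable radon_borel"
      unfolding V_def by blast
    have "\<bar>c * Z \<omega>\<bar> \<le> \<bar>c\<bar> * D" if "\<omega> \<in> configurations" for \<omega>
      using Z(2)[OF that] by (simp add: abs_mult mult_left_mono)
    then show "V (\<lambda>\<omega>. c * Z \<omega>)"
      unfolding V_def using Z(1) m by auto
  next
    fix Z Z' B
    assume V: "\<And>n. V (Z n)" and B: "\<And>n w. w \<in> configurations \<Longrightarrow> \<bar>Z n w\<bar> \<le> B"
      and lim: "\<And>w. w \<in> configurations \<Longrightarrow> (\<lambda>n::nat. Z n w) \<longlonglongrightarrow> Z' w"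
    have Z: "\<And>n. Z n \<in> borel_measurable config_borel" using V by (simp add: V_def)
    have Z': "Z' \<in> borel_measurable config_borel"
      by (rule borel_measurable_LIMSEQ_real[of _ Z]) (use Z lim in auto)
    have bound: "\<bar>Z' w\<bar> \<le> B" if "w \<in> configurations" for w
      using LIMSEQ_le_const2[OF tendsto_rabs[OF lim[OF that]], of B] B[OF that] by auto
    have "(\<lambda>m. \<integral>\<omega>. Z' \<omega> \<partial>\<mu> m) \<in> borel_measurable radon_borel"
    proof (rule borel_measurable_LIMSEQ_real)
      show "(\<lambda>m. \<integral>\<omega>. Z n \<omega> \<partial>\<mu> m) \<in> borel_measurable radon_borel" for n
        using V by (simp add: V_def)
      show "(\<lambda>n. \<integral>\<omega>. Z n \<omega> \<partial>\<mu> m) \<longlonglongrightarrow> (\<integral>\<omega>. Z' \<omega> \<partial>\<mu> m)" if "m \<in> space radon_borel" for m :: "'a measure"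
        using that by (intro bounded_convergence_config[OF P Z B lim]) auto
    qed
    then show "V Z'"
      unfolding V_def using Z' bound by auto
  qed
  then show ?thesis by (simp add: V_def)
qed

lemma poisson_kernel_measurable:
  fixes \<mu> :: "'a::metric_space measure \<Rightarrow> 'a set measure"
  assumes \<sigma>: "sigma_compact (UNIV :: 'a set)"
    and poisson: "\<And>m. m \<in> diffuse_radon \<Longrightarrow> is_poisson m (\<mu> m)"
  shows "\<mu> \<in> radon_borel \<rightarrow>\<^sub>M prob_algebra config_borel"
proof (rule measurable_prob_algebraI)
  show "prob_space (\<mu> m)" if "m \<in> space radon_borel" for m :: "'a measure"
    using that is_poissonD(1)[OF poisson] by simp
  show "\<mu> \<in> radon_borel \<rightarrow>\<^sub>M subprob_algebra config_borel"
  proof (rule measurable_subprob_algebra)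
    fix m :: "'a measure" assume "m \<in> space radon_borel"
    then show "subprob_space (\<mu> m)" "sets (\<mu> m) = sets config_borel"
      using is_poissonD(1,2)[OF poisson] by (auto intro: prob_space_imp_subprob_space)
  next
    fix A assume A: "A \<in> sets (config_borel :: 'a set measure)"
    have "(\<lambda>m. (\<integral>\<omega>. indicator A \<omega> \<partial>\<mu> m) :: real) \<in> borel_measurable radon_borel"
      using A by (intro poisson_kernel_integral_measurable[OF \<sigma> poisson, where C = 1]) auto
    then have "(\<lambda>m. ennreal (\<integral>\<omega>. indicator A \<omega> \<partial>\<mu> m :: real)) \<in> borel_measurable radon_borel"
      by measurable
    then show "(\<lambda>m. emeasure (\<mu> m) A) \<in> borel_measurable radon_borel"
    proof (rule measurable_cong[THEN iffD1, rotated])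
      fix m :: "'a measure" assume "m \<in> space radon_borel"
      then have "is_poisson m (\<mu> m)" using poisson by simp
      then interpret prob_space "\<mu> m" by (rule is_poissonD)
      show "ennreal (\<integral>\<omega>. indicator A \<omega> \<partial>\<mu> m :: real) = emeasure (\<mu> m) A"
        using A is_poissonD(2)[OF \<open>is_poisson m (\<mu> m)\<close>] by (simp add: emeasure_eq_measure)
    qed
  qed
qed

lemma integral_mixed_joint_fst:
  fixes \<mu> :: "'a::metric_space measure \<Rightarrow> 'a set measure"
  assumes \<sigma>: "sigma_compact (UNIV :: 'a set)"
    and poisson: "\<And>m. m \<in> diffuse_radon \<Longrightarrow> is_poisson m (\<mu> m)"
    and P: "prob_space P" "sets P = sets radon_borel"
    and F: "F \<in> borel_measurable config_borel" "\<And>\<omega>. \<omega> \<in> configurations \<Longrightarrow> \<bar>F \<omega>\<bar> \<le> (C::real)"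
  shows "(\<integral>p. F (fst p) \<partial>mixed_joint \<mu> P) = (\<integral>m. (\<integral>\<omega>. F \<omega> \<partial>\<mu> m) \<partial>P)"
proof -
  interpret P: prob_space P by fact
  have space_P: "space P = diffuse_radon" using sets_eq_imp_space_eq[OF P(2)] by simp
  let ?K = "\<lambda>m. distr (\<mu> m) (config_borel \<Otimes>\<^sub>M radon_borel) (\<lambda>\<omega>. (\<omega>, m))"
  have K: "?K \<in> radon_borel \<rightarrow>\<^sub>M subprob_algebra (config_borel \<Otimes>\<^sub>M radon_borel)"
    using measurable_prob_algebraD[OF poisson_kernel_measurable[OF \<sigma> poisson]]
    by (intro measurable_distr2[where M = config_borel]) (auto simp: case_prod_unfold)
  then have KP: "?K \<in> P \<rightarrow>\<^sub>M subprob_algebra (config_borel \<Otimes>\<^sub>M radon_borel)"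
    using P(2) by (simp cong: measurable_cong_sets)
  have mF: "(\<lambda>p. F (fst p)) \<in> borel_measurable (config_borel \<Otimes>\<^sub>M (radon_borel :: 'a measure measure))"
    using F(1) by measurable
  have pair: "(\<lambda>\<omega>. (\<omega>, m)) \<in> \<mu> m \<rightarrow>\<^sub>M config_borel \<Otimes>\<^sub>M radon_borel" if "m \<in> diffuse_radon" for m :: "'a measure"
    using that is_poissonD(2)[OF poisson[OF that]] by (auto cong: measurable_cong_sets)
  have "(\<integral>p. F (fst p) \<partial>mixed_joint \<mu> P) = (\<integral>m. (\<integral>p. F (fst p) \<partial>?K m) \<partial>P)"
    unfolding mixed_joint_def
  proof (rule integral_bind[OF mF _ KP, where B = C and B' = 1])
    show "\<bar>F (fst p)\<bar> \<le> C" if "p \<in> space (config_borel \<Otimes>\<^sub>M (radon_borel :: 'a measure measure))" for p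
      using that F(2) by (auto simp: space_pair_measure)
    show "AE m in P. emeasure (?K m) (space (?K m)) \<le> ennreal 1"
      using subprob_space.subprob_emeasure_le_1[OF subprob_space_kernel[OF KP]] by (intro AE_I2) simp
  qed (rule P.finite_measure_axioms)
  also have "\<dots> = (\<integral>m. (\<integral>\<omega>. F \<omega> \<partial>\<mu> m) \<partial>P)"
    using integral_distr[OF pair mF] by (intro Bochner_Integration.integral_cong) (auto simp: space_P)
  finally show ?thesis .
qed

section \<open>The transport bound\<close>

theorem proposition4p2:
  fixes \<sigma> :: "'a::metric_space measure"
    and \<mu> :: "'a measure \<Rightarrow> 'a set measure"
    and P\<^sub>M :: "'a measure measure"
    and g :: "('a set \<times> 'a measure) \<times> 'a \<Rightarrow> real"
  assumes "sigma_compact (UNIV :: 'a set)"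
    and "\<sigma> \<in> diffuse_radon"
    and poisson: "\<forall>m\<in>diffuse_radon. is_poisson m (\<mu> m)"
    and "prob_space P\<^sub>M" and "sets P\<^sub>M = sets radon_borel"
    and "AE (\<omega>, m) in fixed_joint \<mu> P\<^sub>M \<sigma>. absolutely_continuous \<sigma> m"
    and version: "AE (\<omega>, m) in fixed_joint \<mu> P\<^sub>M \<sigma>. AE x in \<sigma>.
      g ((\<omega>, m), x) = enn2real (RN_deriv \<sigma> m x)"
    and "g \<in> borel_measurable (fixed_joint \<mu> P\<^sub>M \<sigma> \<Otimes>\<^sub>M \<sigma>)"
    and "integrable (fixed_joint \<mu> P\<^sub>M \<sigma> \<Otimes>\<^sub>M \<sigma>) (\<lambda>z. g z - 1)"
  shows "transport_rho1 (fixed_joint \<mu> P\<^sub>M \<sigma>) (mixed_joint \<mu> P\<^sub>M)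
    \<le> ereal (\<integral>p. (\<integral>x. \<bar>g (p, x) - 1\<bar> \<partial>\<sigma>) \<partial>(fixed_joint \<mu> P\<^sub>M \<sigma>))"
  unfolding transport_rho1_def
proof (rule SUP_least)
  fix F :: "'a set \<Rightarrow> real" assume F: "F \<in> rho1_Lip1"
  note sc = assms(1) and s = assms(2)
  have is_p: "\<And>m. m \<in> diffuse_radon \<Longrightarrow> is_poisson m (\<mu> m)" using poisson by blast
  let ?J = "fixed_joint \<mu> P\<^sub>M \<sigma>"
  interpret s: prob_space "\<mu> \<sigma>" by (rule is_poissonD(1)[OF is_p[OF s]])
  interpret PM: prob_space P\<^sub>M by fact
  interpret sP: pair_prob_space "\<mu> \<sigma>" P\<^sub>M ..
  interpret J: prob_space ?J unfolding fixed_joint_def by (rule sP.prob_space_axioms)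
  interpret \<sigma>: sigma_finite_measure \<sigma> by (rule diffuse_radon_sigma_finite[OF sc s])
  interpret J\<sigma>: pair_sigma_finite ?J \<sigma> ..
  have space_P: "space P\<^sub>M = diffuse_radon" using sets_eq_imp_space_eq[OF assms(5)] by simp
  obtain C where C: "\<And>\<omega>. \<omega> \<in> configurations \<Longrightarrow> \<bar>F \<omega>\<bar> \<le> C"
    using rho1_Lip1_bounded[OF F] by blast
  note mF = rho1_Lip1_measurable[OF F]
  define b where "b m = (\<integral>\<omega>. F \<omega> \<partial>\<mu> m)" for m
  have b_meas: "b \<in> borel_measurable P\<^sub>M"
    unfolding b_def using poisson_kernel_integral_measurable[OF sc is_p mF C] assms(5)
    by (simp cong: measurable_cong_sets)
  have b_bound: "\<bar>b m\<bar> \<le> C" if "m \<in> diffuse_radon" for m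
    unfolding b_def by (rule abs_integral_le_bound[OF is_poissonD(1,2)[OF is_p[OF that]] mF C])
  have F_meas: "F \<in> borel_measurable (\<mu> \<sigma>)"
    using mF is_poissonD(2)[OF is_p[OF s]] by (simp cong: measurable_cong_sets)
  have b_snd: "(\<integral>p. b (snd p) \<partial>?J) = (\<integral>m. b m \<partial>P\<^sub>M)"
  proof -
    have i: "integrable (\<mu> \<sigma> \<Otimes>\<^sub>M P\<^sub>M) (\<lambda>p. b (snd p))"
      using b_meas b_bound
      by (intro sP.integrable_const_bound[of _ C] AE_I2) (auto simp: space_pair_measure space_P)
    show ?thesis
      unfolding fixed_joint_def using sP.integral_fst'[OF i] by (simp add: s.prob_space)
  qed
  have F_fst: "(\<integral>p. F (fst p) \<partial>?J) = b \<sigma>"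
    using integral_distr[OF measurable_fst F_meas, of P\<^sub>M] PM.distr_pair_fst[of "\<mu> \<sigma>"]
    by (simp add: fixed_joint_def b_def)
  have int_b: "integrable ?J (\<lambda>p. b (snd p))"
  proof -
    have "(\<lambda>p. b (snd p)) \<in> borel_measurable ?J"
      unfolding fixed_joint_def using b_meas by measurable
    moreover have "\<bar>b (snd p)\<bar> \<le> C" if "p \<in> space ?J" for p
      using that b_bound by (auto simp: fixed_joint_def space_pair_measure space_P)
    ultimately show ?thesis
      by (intro J.integrable_const_bound[of _ C] AE_I2) auto
  qed
  have int_abs: "integrable (?J \<Otimes>\<^sub>M \<sigma>) (\<lambda>z. \<bar>g z - 1\<bar>)"
    using assms(9) by (rule integrable_abs)
  have "AE p in ?J. b \<sigma> - b (snd p) \<le> (\<integral>x. \<bar>g (p, x) - 1\<bar> \<partial>\<sigma>)"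
    using assms(6) version J\<sigma>.AE_integrable_fst'[OF assms(9)] AE_space
  proof eventually_elim
    fix p assume ac: "case p of (\<omega>, m) \<Rightarrow> absolutely_continuous \<sigma> m"
      and v: "case p of (\<omega>, m) \<Rightarrow> AE x in \<sigma>. g ((\<omega>, m), x) = enn2real (RN_deriv \<sigma> m x)"
      and i: "integrable \<sigma> (\<lambda>y. g (p, y) - 1)" and sp: "p \<in> space ?J"
    obtain \<omega> m where p: "p = (\<omega>, m)" by (cases p)
    have m: "m \<in> diffuse_radon" using sp by (auto simp: p fixed_joint_def space_pair_measure space_P)
    have eq: "AE x in \<sigma>. g (p, x) = enn2real (RN_deriv \<sigma> m x)" using v by (simp add: p)
    have gm: "(\<lambda>x. g (p, x)) \<in> borel_measurable \<sigma>"
      using borel_measurable_add[OF borel_measurable_integrable[OF i] borel_measurable_const[of 1]] by simp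
    have i': "integrable \<sigma> (\<lambda>x. enn2real (RN_deriv \<sigma> m x) - 1)"
      using i by (rule integrable_cong_AE_imp) (use eq in auto)
    have "b \<sigma> - b m \<le> (\<integral>x. \<bar>enn2real (RN_deriv \<sigma> m x) - 1\<bar> \<partial>\<sigma>)"
      using poisson_Lip1_RN_deriv[OF sc s m is_p _ i' F] ac by (simp add: p b_def)
    also have "\<dots> = (\<integral>x. \<bar>g (p, x) - 1\<bar> \<partial>\<sigma>)"
      using gm eq by (intro integral_cong_AE) auto
    finally show "b \<sigma> - b (snd p) \<le> (\<integral>x. \<bar>g (p, x) - 1\<bar> \<partial>\<sigma>)" by (simp add: p)
  qed
  then have "(\<integral>p. b \<sigma> - b (snd p) \<partial>?J) \<le> (\<integral>p. (\<integral>x. \<bar>g (p, x) - 1\<bar> \<partial>\<sigma>) \<partial>?J)"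
    using int_b J\<sigma>.integrable_fst'[OF int_abs] by (intro integral_mono_AE) auto
  moreover have "(\<integral>p. b \<sigma> - b (snd p) \<partial>?J) = b \<sigma> - (\<integral>m. b m \<partial>P\<^sub>M)"
    using int_b by (simp add: b_snd J.prob_space)
  moreover have "(\<integral>p. F (fst p) \<partial>mixed_joint \<mu> P\<^sub>M) = (\<integral>m. b m \<partial>P\<^sub>M)"
    unfolding b_def by (rule integral_mixed_joint_fst[OF sc is_p assms(4,5) mF C])
  ultimately show "ereal ((\<integral>p. F (fst p) \<partial>?J) - (\<integral>p. F (fst p) \<partial>mixed_joint \<mu> P\<^sub>M))
    \<le> ereal (\<integral>p. (\<integral>x. \<bar>g (p, x) - 1\<bar> \<partial>\<sigma>) \<partial>?J)"
    by (simp add: F_fst)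
qed

end
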